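(* Let $D$ be a weighted oriented graph consisting of finitely many cycles that share only a single vertex $v$ (any two of these cycles have exactly the vertex $v$ in common). Let $D'$ be a weighted oriented graph obtained from $D$ by adding new cycles $\mathcal{C}_1,\mathcal{C}_2,\ldots,\mathcal{C}_k$, disjoint from $D$, where each cycle $\mathcal{C}_i$ is connected to $D$ at $v$ by a path $P_i$, such that $E(P_i)\cap E(P_j)=\emptyset$ for all distinct $i,j\in\{1,2,\ldots,k\}$. Then the toric ideal $I_{D'}$ is strongly robust.
   Context: A weighted oriented graph is a triple $D=(V(D),E(D),w)$, where $V(D)=\{x_1,\ldots,x_n\}$ is a finite vertex set, $E(D)$ is a set of directed edges $(x_i,x_j)$ (directed from $x_i$ to $x_j$) whose underlying undirected graph has no loops and no multiple edges, and $w$ assigns to each vertex $x_j$ a positive integer weight $w_j=w(x_j)$. Cycles and paths in a weighted oriented graph are cycles and paths of the underlying undirected graph (edges may be oriented in any direction). In the claim, $D'$ is the union of $D$, the cycles $\mathcal{C}_i$ and the paths $P_i$; each $P_i$ has one endpoint $v$ and the other on $\mathcal{C}_i$, and meets $D$ only at $v$; and the only cycles of $D'$ are the cycles of $D$ that make up $D$ together with $\mathcal{C}_1,\ldots,\mathcal{C}_k$. Let $K$ be a field. For a weighted oriented graph $D$ with $E(D)=\{e_1,\ldots,e_m\}$, regarding the edges also as variables, the toric ideal $I_D$ is the kernel of the $K$-algebra homomorphism $K[e_1,\ldots,e_m]\to K[x_1,\ldots,x_n]$ sending the edge $(x_i,x_j)$ to $x_ix_j^{w_j}$. A nonzero binomial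 $\mathbf{e}^{\mathbf{u}}-\mathbf{e}^{\mathbf{v}}$ in a toric ideal $I$ is primitive if there is no other nonzero binomial $\mathbf{e}^{\mathbf{u}'}-\mathbf{e}^{\mathbf{v}'}\in I$ with $\mathbf{e}^{\mathbf{u}'}\mid\mathbf{e}^{\mathbf{u}}$ and $\mathbf{e}^{\mathbf{v}'}\mid\mathbf{e}^{\mathbf{v}}$. The Graver basis of $I$ is the set of all primitive binomials of $I$, where $f$ and $-f$ are identified. The toric ideal $I$ is strongly robust if its Graver basis is a minimal generating set of $I$ (equivalently, if the Graver basis equals the set of indispensable binomials of $I$, i.e. binomials $f\in I$ such that every system of binomial generators of $I$ contains $f$ or $-f$). *)

theory Defs
  imports
    "HOL-Library.Poly_Mapping"
    "HOL-Algebra.RingHom"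
    "Graph_Theory.Digraph_Component"
begin

section \<open>Weighted oriented graphs\<close>

text \<open>
  The pair \<open>(G, w)\<close> is a weighted oriented graph. For a loop-free relation, \<open>antisym\<close> says that
  no two vertices are joined by arcs in both directions, so that the underlying undirected graph
  is simple. Values of \<open>w\<close> outside the vertex set are irrelevant.
\<close>

definition weighted_oriented_graph :: "'v pair_pre_digraph \<Rightarrow> ('v \<Rightarrow> nat) \<Rightarrow> bool" where
  "weighted_oriented_graph G w \<longleftrightarrow>
     pair_digraph G \<and> antisym (parcs G) \<and> (\<forall>x\<in>pverts G. 0 < w x)"

text \<open>
  Cycles and paths are those of the underlying undirected graph, whose edges \<open>{a, b}\<close> are
  represented in \<^const>\<open>mk_symmetric\<close> by the two arcs \<open>(a, b)\<close> and \<open>(b, a)\<close>. The length condition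
  excludes the closed walks \<open>a, b, a\<close>, which the library's \<open>cycle\<close> admits.
\<close>

abbreviation underlying :: "'v pair_pre_digraph \<Rightarrow> 'v pair_pre_digraph" where
  "underlying G \<equiv> mk_symmetric (with_proj G)"

definition cycle_graph :: "'v pair_pre_digraph \<Rightarrow> bool" where
  "cycle_graph H \<longleftrightarrow>
     (\<exists>p. pre_digraph.cycle (with_proj (underlying H)) p \<and> 3 \<le> length p \<and>
        pverts H = fst ` set p \<and> parcs (underlying H) = set p \<union> (set p)\<inverse>)"

definition path_graph :: "'v \<Rightarrow> 'v pair_pre_digraph \<Rightarrow> 'v \<Rightarrow> bool" where
  "path_graph a H b \<longleftrightarrow>
     (\<exists>p. pre_digraph.apath (with_proj (underlying H)) a p b \<and>
        pverts H = set (pawalk_verts a p) \<and> parcs (underlying H) = set p \<union> (set p)\<inverse>)"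


section \<open>Polynomials and toric ideals\<close>

type_synonym ('x, 'k) mpoly = "('x \<Rightarrow>\<^sub>0 nat) \<Rightarrow>\<^sub>0 'k"

text \<open>The polynomial ring over the field \<open>'k\<close> in the variables \<open>X\<close>.\<close>

definition mpoly_ring :: "'x set \<Rightarrow> ('x, 'k::field) mpoly ring" where
  "mpoly_ring X =
     \<lparr>carrier = {p. \<forall>m\<in>Poly_Mapping.keys p. Poly_Mapping.keys m \<subseteq> X},
      monoid.mult = (*), one = 1, zero = 0, add = (+)\<rparr>"

definition monomial :: "('x \<Rightarrow>\<^sub>0 nat) \<Rightarrow> ('x, 'k::field) mpoly" where
  "monomial m = Poly_Mapping.single m 1"

definition var :: "'x \<Rightarrow> ('x, 'k::field) mpoly" where
  "var x = monomial (Poly_Mapping.single x 1)"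

definition const :: "'k::field \<Rightarrow> ('x, 'k) mpoly" where
  "const c = Poly_Mapping.single 0 c"

text \<open>The homomorphism of algebras over \<open>'k\<close> that sends each variable \<open>x\<close> to \<open>f x\<close>.\<close>

definition mpoly_subst ::
    "('x \<Rightarrow> ('y, 'k::field) mpoly) \<Rightarrow> ('x, 'k) mpoly \<Rightarrow> ('y, 'k) mpoly" where
  "mpoly_subst f p =
     (\<Sum>m\<in>Poly_Mapping.keys p.
        const (Poly_Mapping.lookup p m) * (\<Prod>x\<in>Poly_Mapping.keys m. f x ^ Poly_Mapping.lookup m x))"

definition toric_map ::
    "('v \<Rightarrow> nat) \<Rightarrow> ('v \<times> 'v, 'k::field) mpoly \<Rightarrow> ('v, 'k) mpoly" where
  "toric_map w = mpoly_subst (\<lambda>(x, y). var x * var y ^ w y)"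

definition toric_ideal ::
    "'v pair_pre_digraph \<Rightarrow> ('v \<Rightarrow> nat) \<Rightarrow> ('v \<times> 'v, 'k::field) mpoly set" where
  "toric_ideal G w = a_kernel (mpoly_ring (parcs G)) (mpoly_ring (pverts G)) (toric_map w)"


section \<open>Graver bases and strong robustness\<close>

definition primitive_binomial :: "('x, 'k::field) mpoly set \<Rightarrow> ('x, 'k) mpoly \<Rightarrow> bool" where
  "primitive_binomial I f \<longleftrightarrow> f \<in> I \<and> f \<noteq> 0 \<and>
     (\<exists>u v. f = monomial u - monomial v \<and>
        \<not> (\<exists>g u' v'. g = monomial u' - monomial v' \<and> g \<in> I \<and> g \<noteq> 0 \<and> g \<noteq> f \<and>
             (monomial u' :: ('x, 'k) mpoly) dvd monomial u \<and>
             (monomial v' :: ('x, 'k) mpoly) dvd monomial v))"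

text \<open>
  The identification of \<open>f\<close> with \<open>- f\<close> is expressed by choosing one representative of each pair;
  the choice is arbitrary, so strong robustness quantifies over all choices.
\<close>

definition graver_basis :: "('x, 'k::field) mpoly set \<Rightarrow> ('x, 'k) mpoly set \<Rightarrow> bool" where
  "graver_basis I G \<longleftrightarrow> (\<forall>g\<in>G. primitive_binomial I g) \<and>
     (\<forall>f. primitive_binomial I f \<longrightarrow> (\<exists>!g. g \<in> G \<and> (g = f \<or> g = - f)))"

definition minimal_generating_set :: "('a, 'b) ring_scheme \<Rightarrow> 'a set \<Rightarrow> 'a set \<Rightarrow> bool" where
  "minimal_generating_set R I G \<longleftrightarrow>
     G \<subseteq> carrier R \<and> genideal R G = I \<and> (\<forall>H. H \<subset> G \<longrightarrow> genideal R H \<noteq> I)"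

definition strongly_robust ::
    "('x, 'k::field) mpoly ring \<Rightarrow> ('x, 'k) mpoly set \<Rightarrow> bool" where
  "strongly_robust R I \<longleftrightarrow> (\<forall>G. graver_basis I G \<longrightarrow> minimal_generating_set R I G)"


section \<open>Basic properties\<close>

lemma cring_mpoly_ring: "cring (mpoly_ring X :: ('x, 'k::field) mpoly ring)"
proof -
  have closed: "Poly_Mapping.keys m \<subseteq> X"
    if "m \<in> Poly_Mapping.keys (p * q)"
      "\<forall>m\<in>Poly_Mapping.keys p. Poly_Mapping.keys m \<subseteq> X"
      "\<forall>m\<in>Poly_Mapping.keys q. Poly_Mapping.keys m \<subseteq> X"
    for m and p q :: "('x, 'k) mpoly"
  proof -
    from that(1) obtain a b where "m = a + b" "a \<in> Poly_Mapping.keys p" "b \<in> Poly_Mapping.keys q"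
      using keys_mult[of p q] by blast
    then show ?thesis using that keys_add[of a b] by blast
  qed
  have neg: "\<exists>q. (\<forall>m\<in>Poly_Mapping.keys q. Poly_Mapping.keys m \<subseteq> X) \<and> p + q = 0"
    if "\<forall>m\<in>Poly_Mapping.keys p. Poly_Mapping.keys m \<subseteq> X" for p :: "('x, 'k) mpoly"
  proof (intro exI conjI)
    show "\<forall>m\<in>Poly_Mapping.keys (- p). Poly_Mapping.keys m \<subseteq> X"
      using that by (auto simp: in_keys_iff)
  qed simp
  show ?thesis
  proof (intro cringI abelian_groupI comm_monoidI)
    fix p q :: "('x, 'k) mpoly"
    assume "p \<in> carrier (mpoly_ring X)" "q \<in> carrier (mpoly_ring X)"
    then show "p \<oplus>\<^bsub>mpoly_ring X\<^esub> q \<in> carrier (mpoly_ring X)"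
      using keys_add[of p q] by (auto simp: mpoly_ring_def)
  qed (auto simp: mpoly_ring_def algebra_simps dest: closed neg)
qed

lemma mpoly_subst_var: "mpoly_subst f (var x) = (f x :: ('y, 'k::field) mpoly)"
  by (simp add: mpoly_subst_def var_def monomial_def const_def)

lemma mpoly_subst_const: "mpoly_subst f (const c) = (const c :: ('y, 'k::field) mpoly)"
  by (simp add: mpoly_subst_def const_def)

lemma toric_map_edge:
  "toric_map w (var (x, y)) = (var x * var y ^ w y :: ('v, 'k::field) mpoly)"
  by (simp add: toric_map_def mpoly_subst_var)

lemma primitive_binomial_uminus:
  assumes "primitive_binomial I f" and "\<And>g. g \<in> I \<Longrightarrow> - g \<in> I"
  shows "primitive_binomial I (- f)"
proof -
  from assms(1) obtain u v where uv: "f \<in> I" "f \<noteq> 0" "f = monomial u - monomial v"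
    "\<And>u' v'. \<lbrakk>monomial u' - monomial v' \<in> I; monomial u' - monomial v' \<noteq> (0 :: ('a, 'b) mpoly);
        monomial u' - monomial v' \<noteq> f; (monomial u' :: ('a, 'b) mpoly) dvd monomial u;
        (monomial v' :: ('a, 'b) mpoly) dvd monomial v\<rbrakk> \<Longrightarrow> False"
    unfolding primitive_binomial_def by blast
  have False
    if "monomial u' - monomial v' \<in> I" "monomial u' - monomial v' \<noteq> (0 :: ('a, 'b) mpoly)"
      "monomial u' - monomial v' \<noteq> - f" "(monomial u' :: ('a, 'b) mpoly) dvd monomial v"
      "(monomial v' :: ('a, 'b) mpoly) dvd monomial u" for u' v'
    using that uv(4)[of v' u'] assms(2)[OF that(1)] by (auto simp: algebra_simps)
  moreover have "- f = monomial v - monomial u"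
    using uv(3) by simp
  ultimately show ?thesis
    using uv(1,2) assms(2)[OF uv(1)] unfolding primitive_binomial_def neg_equal_0_iff_equal
    by blast
qed

lemma graver_basis_exists:
  assumes "\<And>g. g \<in> I \<Longrightarrow> - g \<in> I"
  shows "\<exists>G. graver_basis I G"
proof -
  define rep where "rep f = (SOME g. g \<in> {f, - f})" for f :: "('a, 'b) mpoly"
  have rep: "rep f = f \<or> rep f = - f" for f
    using someI[of "\<lambda>g. g \<in> {f, - f}" f] unfolding rep_def by blast
  have rep_uminus: "rep (- f) = rep f" for f
    unfolding rep_def by (simp add: insert_commute)
  have "graver_basis I (rep ` {f. primitive_binomial I f})"
    unfolding graver_basis_def
  proof (intro conjI ballI allI impI)
    fix g assume "g \<in> rep ` {f. primitive_binomial I f}"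
    then show "primitive_binomial I g"
      using rep primitive_binomial_uminus[OF _ assms] by (metis imageE mem_Collect_eq)
  next
    fix f assume f: "primitive_binomial I f"
    show "\<exists>!g. g \<in> rep ` {f. primitive_binomial I f} \<and> (g = f \<or> g = - f)"
    proof (rule ex1I[of _ "rep f"])
      show "rep f \<in> rep ` {f. primitive_binomial I f} \<and> (rep f = f \<or> rep f = - f)"
        using f rep by blast
    next
      fix g assume g: "g \<in> rep ` {f. primitive_binomial I f} \<and> (g = f \<or> g = - f)"
      then obtain h where "g = rep h" by blast
      with g rep[of h] have "h = f \<or> h = - f" by (metis minus_minus)
      then show "g = rep f" using \<open>g = rep h\<close> rep_uminus by auto
    qed
  qed
  then show ?thesis by blast
qed

end

theory Submission
  imports Defs
begin

text \<open>
  A binomial of the toric ideal amounts to an integer edge labelling whose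
  weighted sum vanishes at every vertex. At a vertex of degree two this fixes the ratio of the two
  incident labels, and the ratio is negative. Almost every edge of a bouquet of cycles and
  lollipops has an endpoint of degree two; the exception is an edge joining \<open>v\<close> directly to a cycle,
  whose label is in a fixed ratio to the labels of that cycle, and these have both signs. So every
  nonzero label comes with a label of the opposite sign in a fixed ratio to it. Hence,
  if the positive part of one labelling is bounded by the positive part of another, the same holds
  for the negative parts. By this property, a primitive binomial \<open>e\<^sup>u - e\<^sup>v\<close> is, up to sign, the only
  binomial of the ideal with a term dividing \<open>e\<^sup>u\<close>, so no generating set of binomials avoids it.
\<close>

subsection \<open>Kernels of monomial maps\<close>

text \<open>The paths are assumed edge-disjoint only: a priori they may share vertices, touch
  foreign cycles or run along their own cycle, and then the degrees would be wrong. That distinct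
  lollipops share only \<open>v\<close> is extracted from the absence of further cycles, through one
  fact: an edge whose ends stay connected without it lies on a cycle, hence on a listed one.

  Fixed ratios give the comparison of labellings as follows. Let the positive part of
  \<open>d\<close> be bounded by that of \<open>D\<close>. Where \<open>d\<close> is negative, it is
  positive at a partner edge, so \<open>D / d \<ge> 1\<close> holds there; the common ratio carries
  the quotient back, and \<open>D \<le> d\<close> at the original edge.

  That the primitive binomials generate holds for every monomial map in finitely many variables; the
  comparison enters in minimality. The polynomials none of whose terms divides
  \<open>e\<^sup>u\<close> form an ideal, and it contains every other member of a Graver basis but
  not \<open>e\<^sup>u - e\<^sup>v\<close>.\<close>

definition exp_map :: "('x \<Rightarrow> ('y \<Rightarrow>\<^sub>0 nat)) \<Rightarrow> ('x \<Rightarrow>\<^sub>0 nat) \<Rightarrow> ('y \<Rightarrow>\<^sub>0 nat)" where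
  "exp_map g m = (\<Sum>x\<in>Poly_Mapping.keys m. \<Sum>i<Poly_Mapping.lookup m x. g x)"

text \<open>The freedom in \<open>X\<close> lets exponents with different supports be compared over
  one index set.\<close>

lemma lookup_exp_map:
  assumes "finite X" "Poly_Mapping.keys m \<subseteq> X"
  shows "Poly_Mapping.lookup (exp_map g m) y =
    (\<Sum>x\<in>X. Poly_Mapping.lookup m x * Poly_Mapping.lookup (g x) y)"
proof -
  have "Poly_Mapping.lookup (exp_map g m) y =
      (\<Sum>x\<in>Poly_Mapping.keys m. Poly_Mapping.lookup m x * Poly_Mapping.lookup (g x) y)"
    by (simp add: exp_map_def lookup_sum)
  also have "\<dots> = (\<Sum>x\<in>X. Poly_Mapping.lookup m x * Poly_Mapping.lookup (g x) y)"
    using assms by (intro sum.mono_neutral_left) (auto simp: in_keys_iff)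
  finally show ?thesis .
qed

lemma exp_map_add: "exp_map g (m + n) = exp_map g m + exp_map g n"
proof (rule poly_mapping_eqI)
  fix y
  let ?X = "Poly_Mapping.keys m \<union> Poly_Mapping.keys n"
  have "Poly_Mapping.keys (m + n) \<subseteq> ?X" by (rule keys_add)
  then show "Poly_Mapping.lookup (exp_map g (m + n)) y = Poly_Mapping.lookup (exp_map g m + exp_map g n) y"
    by (simp add: lookup_exp_map[of ?X] lookup_add algebra_simps sum.distrib)
qed

section \<open>Monomials, binomials and the substitution homomorphism\<close>

lemma monomial_mult: "monomial m * monomial n = (monomial (m + n) :: ('x, 'k::field) mpoly)"
  by (simp add: monomial_def mult_single)

lemma monomial_sum: "(\<Prod>i\<in>A. monomial (f i)) = (monomial (\<Sum>i\<in>A. f i) :: ('x, 'k::field) mpoly)"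
  by (induction A rule: infinite_finite_induct) (auto simp: monomial_mult, auto simp: monomial_def)

lemma monomial_eq_iff: "monomial m = (monomial n :: ('x, 'k::field) mpoly) \<longleftrightarrow> m = n"
  unfolding monomial_def by (metis one_neq_zero lookup_single_eq lookup_single_not_eq)

text \<open>The exchanged alternative is real: in characteristic 2 both terms of a binomial carry
  the same coefficient.\<close>

lemma binomial_eqD:
  assumes "monomial a - monomial b = (monomial u - monomial v :: ('x, 'k::field) mpoly)" "u \<noteq> v"
  shows "a = u \<and> b = v \<or> a = v \<and> b = u"
proof -
  have "Poly_Mapping.lookup (monomial a - monomial b :: ('x, 'k) mpoly) m =
     Poly_Mapping.lookup (monomial u - monomial v :: ('x, 'k) mpoly) m" for m
    using assms(1) by simp
  then have "(if a = m then 1 else 0) - (if b = m then 1 else 0) =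
      (if u = m then 1 else 0) - (if v = m then (1::'k) else 0)" for m
    by (simp add: lookup_minus monomial_def lookup_single when_def)
  from this[of u] this[of v] this[of a] assms(2) show ?thesis
    by (auto split: if_splits)
qed

lemma monomial_dvd_iff:
  "(monomial m :: ('x, 'k::field) mpoly) dvd monomial n \<longleftrightarrow>
    (\<forall>x. Poly_Mapping.lookup m x \<le> Poly_Mapping.lookup n x)"
proof
  assume "(monomial m :: ('x, 'k) mpoly) dvd monomial n"
  then obtain q where q: "monomial n = (monomial m * q :: ('x, 'k) mpoly)" by blast
  have "n \<in> Poly_Mapping.keys (monomial n :: ('x, 'k) mpoly)" by (simp add: monomial_def)
  with q have "n \<in> Poly_Mapping.keys (monomial m * q)" by simp
  then obtain b where "n = m + b" using keys_mult[of "monomial m" q] by (auto simp: monomial_def)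
  then show "\<forall>x. Poly_Mapping.lookup m x \<le> Poly_Mapping.lookup n x" by (simp add: lookup_add)
next
  assume "\<forall>x. Poly_Mapping.lookup m x \<le> Poly_Mapping.lookup n x"
  then have "n = m + (n - m)" by (intro poly_mapping_eqI) (simp add: lookup_add lookup_minus)
  then show "(monomial m :: ('x, 'k) mpoly) dvd monomial n"
    by (metis dvd_triv_left monomial_mult)
qed

lemma sum_single_keys: "(p :: _ \<Rightarrow>\<^sub>0 _::comm_monoid_add) = (\<Sum>m\<in>Poly_Mapping.keys p. Poly_Mapping.single m (Poly_Mapping.lookup p m))"
proof (rule poly_mapping_eqI)
  fix n
  show "Poly_Mapping.lookup p n = Poly_Mapping.lookup
     (\<Sum>m\<in>Poly_Mapping.keys p. Poly_Mapping.single m (Poly_Mapping.lookup p m)) n"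
    by (simp add: lookup_sum lookup_single when_def sum.delta in_keys_iff)
qed

lemma mpoly_induct [case_names zero single add]:
  fixes p :: "_ \<Rightarrow>\<^sub>0 _::comm_monoid_add"
  assumes "P 0" "\<And>m c. P (Poly_Mapping.single m c)" "\<And>p q. P p \<Longrightarrow> P q \<Longrightarrow> P (p + q)"
  shows "P p"
proof -
  have "P (\<Sum>m\<in>A. Poly_Mapping.single m (c m))" for A c
    by (induction A rule: infinite_finite_induct) (auto intro: assms)
  then show ?thesis using sum_single_keys[of p] by metis
qed

text \<open>Products of powers of monomials collapse to one monomial, so the substitution only
  regroups coefficients by image exponent.\<close>

lemma mpoly_subst_monomial:
  "mpoly_subst (\<lambda>x. monomial (g x)) p =
    (\<Sum>m\<in>Poly_Mapping.keys p. Poly_Mapping.single (exp_map g m) (Poly_Mapping.lookup p m :: 'k::field))"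
proof -
  have "monomial m ^ n = (monomial (\<Sum>i<n. m) :: ('a, 'k) mpoly)" for m n
    using monomial_sum[of "\<lambda>_. m" "{..<n}"] by simp
  then show ?thesis
    unfolding mpoly_subst_def exp_map_def
    by (simp only: monomial_sum) (simp add: const_def monomial_def mult_single)
qed

context
  fixes g :: "'x \<Rightarrow> ('y \<Rightarrow>\<^sub>0 nat)" and h :: "('x, 'k::field) mpoly \<Rightarrow> ('y, 'k) mpoly"
  defines "h \<equiv> mpoly_subst (\<lambda>x. monomial (g x))"
begin

lemma subst_superset:
  assumes "finite A" "Poly_Mapping.keys p \<subseteq> A"
  shows "h p = (\<Sum>m\<in>A. Poly_Mapping.single (exp_map g m) (Poly_Mapping.lookup p m))"
  unfolding h_def mpoly_subst_monomial
  using assms by (intro sum.mono_neutral_left) (auto simp: in_keys_iff)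

lemma subst_add: "h (p + q) = h p + h q"
  using keys_add[of p q] by (simp add: subst_superset[of "Poly_Mapping.keys p \<union> Poly_Mapping.keys q"]
    lookup_add single_add sum.distrib)

lemma subst_zero: "h 0 = 0"
  unfolding h_def by (simp add: mpoly_subst_monomial)

lemma subst_uminus: "h (- p) = - h p"
  using subst_add[of p "- p"] by (simp add: subst_zero eq_neg_iff_add_eq_0 add.commute)

lemma subst_minus: "h (p - q) = h p - h q"
  using subst_add[of p "- q"] by (simp add: subst_uminus)

lemma subst_single: "h (Poly_Mapping.single m c) = Poly_Mapping.single (exp_map g m) c"
  by (simp add: subst_superset[of "{m}"])

lemma subst_monomial: "h (monomial m) = monomial (exp_map g m)"
  by (simp add: monomial_def subst_single)

lemma subst_mult: "h (p * q) = h p * h q"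
proof (induction p rule: mpoly_induct)
  case (single m c)
  show ?case
    by (induction q rule: mpoly_induct)
      (simp_all add: subst_zero subst_single mult_single exp_map_add subst_add distrib_left)
qed (simp_all add: subst_zero subst_add distrib_right)

end

section \<open>Ideals of the polynomial ring and the kernel of a monomial map\<close>

lemma a_inv_mpoly_ring:
  assumes "p \<in> carrier (mpoly_ring X :: ('x, 'k::field) mpoly ring)"
  shows "\<ominus>\<^bsub>mpoly_ring X\<^esub> p = - p"
proof -
  interpret cring "mpoly_ring X :: ('x, 'k) mpoly ring" by (rule cring_mpoly_ring)
  show ?thesis using assms
    by (intro minus_equality) (auto simp: mpoly_ring_def in_keys_iff)
qed

text \<open>A criterion in the operations of the type rather than those of the ring record;
  negatives come from multiplying by \<open>- 1\<close>.\<close>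

lemma ideal_mpoly_ringI:
  fixes I :: "('x, 'k::field) mpoly set"
  assumes "I \<subseteq> carrier (mpoly_ring X)" "0 \<in> I" "\<And>p q. p \<in> I \<Longrightarrow> q \<in> I \<Longrightarrow> p + q \<in> I"
    "\<And>p q. p \<in> I \<Longrightarrow> q \<in> carrier (mpoly_ring X) \<Longrightarrow> q * p \<in> I"
  shows "ideal I (mpoly_ring X)"
proof -
  interpret cring "mpoly_ring X :: ('x, 'k) mpoly ring" by (rule cring_mpoly_ring)
  have neg: "- p \<in> I" if "p \<in> I" for p
  proof -
    have "- 1 \<in> carrier (mpoly_ring X :: ('x, 'k) mpoly ring)"
      by (auto simp: mpoly_ring_def in_keys_iff lookup_one when_def split: if_splits)
    from assms(4)[OF that this] show ?thesis by simp
  qed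
  show ?thesis
  proof (rule idealI)
    show "ring (mpoly_ring X :: ('x, 'k) mpoly ring)" by (rule ring_axioms)
    show "subgroup I (add_monoid (mpoly_ring X))"
    proof (rule subgroup.intro)
      fix p assume "p \<in> I"
      then have "inv\<^bsub>add_monoid (mpoly_ring X)\<^esub> p = - p"
        using assms(1) a_inv_mpoly_ring[of p X] unfolding a_inv_def by blast
      then show "inv\<^bsub>add_monoid (mpoly_ring X)\<^esub> p \<in> I" using neg \<open>p \<in> I\<close> by simp
    qed (use assms in \<open>auto simp: mpoly_ring_def\<close>)
    show "q \<otimes>\<^bsub>mpoly_ring X\<^esub> p \<in> I" "p \<otimes>\<^bsub>mpoly_ring X\<^esub> q \<in> I"
      if "p \<in> I" "q \<in> carrier (mpoly_ring X)" for p q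
      using assms(4)[OF that] by (auto simp: mpoly_ring_def mult.commute)
  qed
qed

lemma monomial_in_mpoly_ring [simp]:
  "(monomial m :: ('x, 'k::field) mpoly) \<in> carrier (mpoly_ring X) \<longleftrightarrow> Poly_Mapping.keys m \<subseteq> X"
  by (simp add: mpoly_ring_def monomial_def)

lemma mpoly_ring_closed:
  fixes p q :: "('x, 'k::field) mpoly"
  assumes "p \<in> carrier (mpoly_ring X)" "q \<in> carrier (mpoly_ring X)"
  shows "p + q \<in> carrier (mpoly_ring X)" "p - q \<in> carrier (mpoly_ring X)" "p * q \<in> carrier (mpoly_ring X)"
proof -
  interpret cring "mpoly_ring X :: ('x, 'k) mpoly ring" by (rule cring_mpoly_ring)
  have eqs: "p \<oplus>\<^bsub>mpoly_ring X\<^esub> q = p + q" "p \<otimes>\<^bsub>mpoly_ring X\<^esub> q = p * q" for p q :: "('x, 'k) mpoly"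
    by (simp_all add: mpoly_ring_def)
  show "p + q \<in> carrier (mpoly_ring X)" "p * q \<in> carrier (mpoly_ring X)"
    using assms a_closed[OF assms] m_closed[OF assms] by (simp_all add: eqs)
  have "p \<ominus>\<^bsub>mpoly_ring X\<^esub> q = p - q"
    unfolding a_minus_def using a_inv_mpoly_ring[OF assms(2)] by (simp add: eqs)
  then show "p - q \<in> carrier (mpoly_ring X)" using minus_closed[OF assms] by simp
qed

lemma binomial_in_mpoly_ring:
  assumes "(monomial u - monomial v :: ('x, 'k::field) mpoly) \<in> carrier (mpoly_ring X)" "u \<noteq> v"
  shows "Poly_Mapping.keys u \<subseteq> X" "Poly_Mapping.keys v \<subseteq> X"
proof -
  have "u \<in> Poly_Mapping.keys (monomial u - monomial v :: ('x, 'k) mpoly)"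
    "v \<in> Poly_Mapping.keys (monomial u - monomial v :: ('x, 'k) mpoly)"
    using assms(2) by (auto simp: in_keys_iff lookup_minus monomial_def lookup_single when_def)
  then show "Poly_Mapping.keys u \<subseteq> X" "Poly_Mapping.keys v \<subseteq> X"
    using assms(1) by (auto simp: mpoly_ring_def)
qed

definition monomial_kernel ::
    "'x set \<Rightarrow> ('x \<Rightarrow> ('y \<Rightarrow>\<^sub>0 nat)) \<Rightarrow> ('x, 'k::field) mpoly set" where
  "monomial_kernel X g =
     {p \<in> carrier (mpoly_ring X). mpoly_subst (\<lambda>x. monomial (g x) :: ('y, 'k) mpoly) p = 0}"

lemma ideal_monomial_kernel: "ideal (monomial_kernel X g) (mpoly_ring X)"
  by (rule ideal_mpoly_ringI)
    (auto simp: monomial_kernel_def subst_zero subst_add subst_mult mpoly_ring_closed, simp add: mpoly_ring_def)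

lemma binomial_in_monomial_kernel:
  fixes u v :: "'x \<Rightarrow>\<^sub>0 nat"
  assumes "u \<noteq> v"
  shows "(monomial u - monomial v :: ('x, 'k::field) mpoly) \<in> monomial_kernel X g \<longleftrightarrow>
    Poly_Mapping.keys u \<subseteq> X \<and> Poly_Mapping.keys v \<subseteq> X \<and> exp_map g u = exp_map g v"
  using binomial_in_mpoly_ring[of u v X, where 'k = 'k, OF _ assms]
  by (auto simp: monomial_kernel_def mpoly_ring_closed subst_minus subst_monomial monomial_eq_iff)

lemma ideal_mpoly_ringD:
  fixes J :: "('x, 'k::field) mpoly set"
  assumes "ideal J (mpoly_ring X)"
  shows "0 \<in> J" "\<And>p q. p \<in> J \<Longrightarrow> q \<in> J \<Longrightarrow> p + q \<in> J"
    "\<And>p q. p \<in> J \<Longrightarrow> q \<in> carrier (mpoly_ring X) \<Longrightarrow> q * p \<in> J"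
  using additive_subgroup.zero_closed[OF ideal.axioms(1)[OF assms]]
    additive_subgroup.a_closed[OF ideal.axioms(1)[OF assms]] ideal.I_l_closed[OF assms]
  by (simp_all add: mpoly_ring_def)

subsection \<open>Graver bases of kernels of monomial maps\<close>

text \<open>Induction on the total degree of both terms. A binomial that is not primitive has a
  proper termwise divisor \<open>a\<close>, \<open>b\<close> in the kernel; this divisor and the
  cofactor \<open>u - a\<close>, \<open>v - b\<close> both have smaller total degree, and the
  binomial is a combination of the two.\<close>

lemma binomial_kernel_generated:
  fixes J :: "('x, 'k::field) mpoly set"
  assumes X: "finite X" and J: "ideal J (mpoly_ring X)"
    and prim: "\<And>f. primitive_binomial (monomial_kernel X g) f \<Longrightarrow> f \<in> J"
    and "Poly_Mapping.keys u \<subseteq> X" "Poly_Mapping.keys v \<subseteq> X" "exp_map g u = exp_map g v"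
  shows "monomial u - monomial v \<in> J"
  using assms(4-)
proof (induction "\<Sum>x\<in>X. Poly_Mapping.lookup u x + Poly_Mapping.lookup v x" arbitrary: u v rule: less_induct)
  case less
  let ?I = "monomial_kernel X g :: ('x, 'k) mpoly set"
  let ?f = "monomial u - monomial v :: ('x, 'k) mpoly"
  note zero = ideal_mpoly_ringD(1)[OF J] and add = ideal_mpoly_ringD(2)[OF J]
    and mult = ideal_mpoly_ringD(3)[OF J]
  show ?case
  proof (cases "u = v \<or> primitive_binomial ?I ?f")
    case True
    then show ?thesis using prim zero by auto
  next
    case False
    then have "u \<noteq> v" by blast
    then have "?f \<in> ?I" "?f \<noteq> 0"
      using less.prems by (simp_all add: binomial_in_monomial_kernel monomial_eq_iff)
    with False obtain a b where ab: "(monomial a - monomial b :: ('x, 'k) mpoly) \<in> ?I"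
      "(monomial a - monomial b :: ('x, 'k) mpoly) \<noteq> 0" "(monomial a - monomial b :: ('x, 'k) mpoly) \<noteq> ?f"
      "(monomial a :: ('x, 'k) mpoly) dvd monomial u" "(monomial b :: ('x, 'k) mpoly) dvd monomial v"
      unfolding primitive_binomial_def by blast
    then have "a \<noteq> b" by auto
    with ab(1) have k: "Poly_Mapping.keys a \<subseteq> X" "Poly_Mapping.keys b \<subseteq> X" "exp_map g a = exp_map g b"
      by (simp_all add: binomial_in_monomial_kernel)
    have le: "Poly_Mapping.lookup a x \<le> Poly_Mapping.lookup u x"
      "Poly_Mapping.lookup b x \<le> Poly_Mapping.lookup v x" for x
      using ab(4,5) by (simp_all add: monomial_dvd_iff)
    have uv: "u = a + (u - a)" "v = b + (v - b)"
      using le by (auto intro!: poly_mapping_eqI simp: lookup_add lookup_minus)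
    have "exp_map g a + exp_map g (u - a) = exp_map g a + exp_map g (v - b)"
      using less.prems(3) uv k(3) exp_map_add by metis
    then have k': "exp_map g (u - a) = exp_map g (v - b)" by simp
    have keys': "Poly_Mapping.keys (u - a) \<subseteq> X" "Poly_Mapping.keys (v - b) \<subseteq> X"
      using less.prems(1,2) by (auto simp: in_keys_iff lookup_minus)
    \<comment> \<open>Equality at every variable would make the divisor the binomial itself.\<close>
    have "\<exists>x\<in>X. Poly_Mapping.lookup a x + Poly_Mapping.lookup b x < Poly_Mapping.lookup u x + Poly_Mapping.lookup v x"
    proof (rule ccontr)
      assume "\<not> ?thesis"
      then have "Poly_Mapping.lookup a x = Poly_Mapping.lookup u x \<and> Poly_Mapping.lookup b x = Poly_Mapping.lookup v x"
        if "x \<in> X" for x using le[of x] that by fastforce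
      moreover have "Poly_Mapping.lookup a x = Poly_Mapping.lookup u x \<and> Poly_Mapping.lookup b x = Poly_Mapping.lookup v x"
        if "x \<notin> X" for x using k less.prems(1,2) that by (metis in_keys_iff subsetD)
      ultimately have "a = u" "b = v" by (auto intro!: poly_mapping_eqI)
      with ab(3) show False by simp
    qed
    then have 1: "monomial a - monomial b \<in> J"
      using X le by (intro less.hyps k sum_strict_mono_ex1) (auto intro: add_mono)
    \<comment> \<open>The cofactor is smaller because \<open>a\<close> and \<open>b\<close> differ,
      so they are not both 0.\<close>
    have "\<exists>x\<in>X. 0 < Poly_Mapping.lookup a x + Poly_Mapping.lookup b x"
    proof (rule ccontr)
      assume "\<not> ?thesis"
      then have "Poly_Mapping.lookup a x = 0 \<and> Poly_Mapping.lookup b x = 0" for x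
        using k by (cases "x \<in> X") (auto simp: in_keys_iff)
      then have "a = b" by (auto intro!: poly_mapping_eqI)
      with \<open>a \<noteq> b\<close> show False by simp
    qed
    then obtain x0 where x0: "x0 \<in> X" "0 < Poly_Mapping.lookup a x0 + Poly_Mapping.lookup b x0"
      by (rule bexE)
    have "\<exists>x\<in>X. Poly_Mapping.lookup (u - a) x + Poly_Mapping.lookup (v - b) x
        < Poly_Mapping.lookup u x + Poly_Mapping.lookup v x"
    proof (rule bexI[OF _ x0(1)])
      show "Poly_Mapping.lookup (u - a) x0 + Poly_Mapping.lookup (v - b) x0
        < Poly_Mapping.lookup u x0 + Poly_Mapping.lookup v x0"
        using x0(2) le[of x0] unfolding lookup_minus by linarith
    qed
    then have 2: "monomial (u - a) - monomial (v - b) \<in> J"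
      using X by (intro less.hyps keys' k' sum_strict_mono_ex1) (auto simp: lookup_minus intro: add_mono)
    \<comment> \<open>Both products contain the mixed term with exponent \<open>(u - a) + b\<close>,
      which cancels.\<close>
    have "?f = monomial (u - a) * (monomial a - monomial b) + monomial b * (monomial (u - a) - monomial (v - b))"
      using uv[symmetric] by (simp add: right_diff_distrib monomial_mult add.commute)
    also have "\<dots> \<in> J" using 1 2 keys' k by (intro add mult) auto
    finally show ?thesis .
  qed
qed

text \<open>Induction on the number of terms. The coefficients of the terms with a given image
  exponent add up to 0, so a term \<open>m\<close> never stands alone: another term \<open>n\<close>
  has the same image, and subtracting a multiple of their binomial removes \<open>m\<close> and
  creates no new term.\<close>

lemma monomial_kernel_generated:
  fixes J :: "('x, 'k::field) mpoly set"
  assumes X: "finite X" and J: "ideal J (mpoly_ring X)"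
    and prim: "\<And>f. primitive_binomial (monomial_kernel X g) f \<Longrightarrow> f \<in> J"
  shows "monomial_kernel X g \<subseteq> J"
proof
  fix p :: "('x, 'k) mpoly"
  let ?I = "monomial_kernel X g :: ('x, 'k) mpoly set"
  note zero = ideal_mpoly_ringD(1)[OF J] and add = ideal_mpoly_ringD(2)[OF J]
    and mult = ideal_mpoly_ringD(3)[OF J]
  assume "p \<in> ?I"
  then show "p \<in> J"
  proof (induction "card (Poly_Mapping.keys p)" arbitrary: p rule: less_induct)
    case less
    show ?case
    proof (cases "p = 0")
      case False
      then obtain m where m: "m \<in> Poly_Mapping.keys p" by fastforce
      have keysX: "Poly_Mapping.keys n \<subseteq> X" if "n \<in> Poly_Mapping.keys p" for n
        using less.prems that by (auto simp: monomial_kernel_def mpoly_ring_def)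
      let ?c = "Poly_Mapping.lookup p"
      have "0 = Poly_Mapping.lookup (mpoly_subst (\<lambda>x. monomial (g x)) p) (exp_map g m)"
        using less.prems by (simp add: monomial_kernel_def)
      also have "\<dots> = (\<Sum>n\<in>Poly_Mapping.keys p. if exp_map g n = exp_map g m then ?c n else 0)"
        by (simp add: mpoly_subst_monomial lookup_sum lookup_single when_def)
      also have "\<dots> = ?c m + (\<Sum>n\<in>Poly_Mapping.keys p - {m}. if exp_map g n = exp_map g m then ?c n else 0)"
        using m by (simp add: sum.remove)
      finally have "(\<Sum>n\<in>Poly_Mapping.keys p - {m}. if exp_map g n = exp_map g m then ?c n else 0) \<noteq> 0"
        using m by (metis add_0_right in_keys_iff)
      then obtain n where n: "n \<in> Poly_Mapping.keys p" "n \<noteq> m" "exp_map g n = exp_map g m"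
        using sum.not_neutral_contains_not_neutral by (force split: if_splits)
      let ?b = "monomial m - monomial n :: ('x, 'k) mpoly"
      have b: "?b \<in> J" "?b \<in> ?I"
        using m n binomial_kernel_generated[OF X J prim, where g = g and u = m and v = n] keysX
        by (simp_all add: binomial_in_monomial_kernel)
      have const: "const c \<in> carrier (mpoly_ring X)" for c :: 'k
        by (simp add: mpoly_ring_def const_def)
      let ?q = "p - const (?c m) * ?b"
      have "ideal ?I (mpoly_ring X)" by (rule ideal_monomial_kernel)
      note I = ideal_mpoly_ringD[OF \<open>ideal ?I (mpoly_ring X)\<close>]
      have "const (- ?c m) * ?b \<in> ?I"
        by (rule I(3)[OF b(2) const])
      then have "p + const (- ?c m) * ?b \<in> ?I"
        by (rule I(2)[OF less.prems])
      then have "?q \<in> ?I" by (simp add: const_def single_uminus)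
      moreover have "Poly_Mapping.keys ?q \<subset> Poly_Mapping.keys p"
      proof -
        have "Poly_Mapping.lookup ?q k = ?c k - (if k = m then ?c m else if k = n then - ?c m else 0)" for k
          using n(2) by (auto simp: const_def monomial_def right_diff_distrib mult_single lookup_minus
            lookup_single when_def)
        then show ?thesis using m n by (auto simp: in_keys_iff split: if_splits)
      qed
      ultimately have "?q \<in> J" using less.hyps by (simp add: psubset_card_mono)
      moreover have "p = ?q + const (?c m) * ?b" by simp
      ultimately show ?thesis using add mult[OF b(1) const] by metis
    qed (simp add: zero)
  qed
qed

text \<open>A term of \<open>q * p\<close> is a product of a term of \<open>q\<close> and one of
  \<open>p\<close>; if it divides the monomial with exponent \<open>u\<close>, so does the factor
  from \<open>p\<close>. The ideal serves to separate a primitive binomial from the other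
  generators.\<close>

lemma ideal_no_divisors_of:
  "ideal {p \<in> carrier (mpoly_ring X). \<forall>m. (\<forall>x. Poly_Mapping.lookup m x \<le> Poly_Mapping.lookup u x) \<longrightarrow>
     Poly_Mapping.lookup p m = 0} (mpoly_ring X :: ('x, 'k::field) mpoly ring)"
proof (rule ideal_mpoly_ringI, goal_cases)
  case (4 p q)
  have "Poly_Mapping.lookup (q * p) m = 0" if le: "\<forall>x. Poly_Mapping.lookup m x \<le> Poly_Mapping.lookup u x" for m
  proof (rule ccontr)
    assume "Poly_Mapping.lookup (q * p) m \<noteq> 0"
    then obtain a b where "m = a + b" "b \<in> Poly_Mapping.keys p"
      using keys_mult[of q p] by (fastforce simp: in_keys_iff)
    moreover from this have "Poly_Mapping.lookup b x \<le> Poly_Mapping.lookup u x" for x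
      using le[rule_format, of x] by (simp add: lookup_add)
    ultimately show False using 4 by (auto simp: in_keys_iff)
  qed
  then show ?case using 4 by (simp add: mpoly_ring_closed)
qed (auto simp: mpoly_ring_closed lookup_add, simp add: mpoly_ring_def)

text \<open>
  Truncated subtraction of exponents computes positive parts: \<open>u - v\<close> and \<open>v - u\<close> are the positive and
  the negative part of the difference vector.
\<close>

theorem strongly_robust_monomial_kernel:
  fixes g :: "'x \<Rightarrow> ('y \<Rightarrow>\<^sub>0 nat)"
  assumes X: "finite X"
    and pos_neg: "\<And>u v a b x. \<lbrakk>Poly_Mapping.keys u \<subseteq> X; Poly_Mapping.keys v \<subseteq> X;
        Poly_Mapping.keys a \<subseteq> X; Poly_Mapping.keys b \<subseteq> X;
        exp_map g u = exp_map g v; exp_map g a = exp_map g b;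
        \<And>x. Poly_Mapping.lookup a x - Poly_Mapping.lookup b x
           \<le> Poly_Mapping.lookup u x - Poly_Mapping.lookup v x\<rbrakk>
      \<Longrightarrow> Poly_Mapping.lookup b x - Poly_Mapping.lookup a x
           \<le> Poly_Mapping.lookup v x - Poly_Mapping.lookup u x"
  shows "strongly_robust (mpoly_ring X) (monomial_kernel X g :: ('x, 'k::field) mpoly set)"
proof -
  let ?I = "monomial_kernel X g :: ('x, 'k) mpoly set"
  let ?R = "mpoly_ring X :: ('x, 'k) mpoly ring"
  interpret R: cring ?R by (rule cring_mpoly_ring)
  \<comment> \<open>The core: a binomial whose first term divides that of a primitive binomial is
    that binomial. Common factors are cancelled on both sides; the hypothesis bounds
    \<open>b - a\<close> by \<open>v - u\<close>, and primitivity applied to \<open>a - b\<close>,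
    \<open>b - a\<close> leaves no freedom. \<open>min\<close> is primitivity stated on
    exponents.\<close>
  have indispensable: "monomial a - monomial b = (monomial u - monomial v :: ('x, 'k) mpoly)"
    if f: "(monomial u - monomial v :: ('x, 'k) mpoly) \<in> ?I" "u \<noteq> v"
      and min: "\<And>u' v'. \<lbrakk>monomial u' - monomial v' \<in> ?I; u' \<noteq> v';
        \<And>x. Poly_Mapping.lookup u' x \<le> Poly_Mapping.lookup u x;
        \<And>x. Poly_Mapping.lookup v' x \<le> Poly_Mapping.lookup v x\<rbrakk>
        \<Longrightarrow> monomial u' - monomial v' = (monomial u - monomial v :: ('x, 'k) mpoly)"
      and ab: "(monomial a - monomial b :: ('x, 'k) mpoly) \<in> ?I" "a \<noteq> b"
        "\<And>x. Poly_Mapping.lookup a x \<le> Poly_Mapping.lookup u x"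
    for u v a b
  proof -
    have reduce: "(monomial (m - n) - monomial (n - m) :: ('x, 'k) mpoly) \<in> ?I" "m - n \<noteq> n - m"
      if mn: "(monomial m - monomial n :: ('x, 'k) mpoly) \<in> ?I" "m \<noteq> n" for m n
    proof -
      have k: "Poly_Mapping.keys m \<subseteq> X" "Poly_Mapping.keys n \<subseteq> X" "exp_map g m = exp_map g n"
        using mn by (simp_all add: binomial_in_monomial_kernel)
      have eq: "m + (n - m) = n + (m - n)"
        by (intro poly_mapping_eqI) (simp add: lookup_add lookup_minus)
      then have "exp_map g (m - n) = exp_map g (n - m)"
        using k(3) exp_map_add add_left_imp_eq by metis
      moreover show "m - n \<noteq> n - m" using eq mn(2) by auto
      ultimately show "(monomial (m - n) - monomial (n - m) :: ('x, 'k) mpoly) \<in> ?I"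
        using k by (auto simp: binomial_in_monomial_kernel in_keys_iff lookup_minus)
    qed
    \<comment> \<open>Equal binomials may have their terms exchanged; the bounds would then force
      \<open>u = v\<close>.\<close>
    have swap: "u' = u \<and> v' = v"
      if "(monomial u' - monomial v' :: ('x, 'k) mpoly) \<in> ?I" "u' \<noteq> v'"
        "\<And>x. Poly_Mapping.lookup u' x \<le> Poly_Mapping.lookup u x"
        "\<And>x. Poly_Mapping.lookup v' x \<le> Poly_Mapping.lookup v x" for u' v'
    proof -
      from min[OF that] have "monomial u' - monomial v' = (monomial u - monomial v :: ('x, 'k) mpoly)" .
      from binomial_eqD[OF this f(2)] show ?thesis
      proof
        assume "u' = v \<and> v' = u"
        with that(3,4) have "u = v" by (auto intro!: poly_mapping_eqI simp: order_antisym)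
        with f(2) show ?thesis by simp
      qed
    qed
    \<comment> \<open>Cancelling the common factor gives a binomial of the kernel that divides the
      primitive one termwise, so the primitive one has coprime terms.\<close>
    have cop: "u - v = u" "v - u = v"
      using swap[OF reduce[OF f]] by (auto simp: lookup_minus)
    have pos: "Poly_Mapping.lookup a x - Poly_Mapping.lookup b x \<le> Poly_Mapping.lookup u x - Poly_Mapping.lookup v x" for x
      using ab(3)[of x] arg_cong[OF cop(1), of "\<lambda>p. Poly_Mapping.lookup p x"] by (simp add: lookup_minus)
    have "Poly_Mapping.lookup b x - Poly_Mapping.lookup a x \<le> Poly_Mapping.lookup v x - Poly_Mapping.lookup u x" for x
    proof (rule pos_neg[OF _ _ _ _ _ _ pos])
      show "Poly_Mapping.keys u \<subseteq> X" "Poly_Mapping.keys v \<subseteq> X" "exp_map g u = exp_map g v"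
        using f(1) by (simp_all add: binomial_in_monomial_kernel[OF f(2)])
      show "Poly_Mapping.keys a \<subseteq> X" "Poly_Mapping.keys b \<subseteq> X" "exp_map g a = exp_map g b"
        using ab(1) by (simp_all add: binomial_in_monomial_kernel[OF ab(2)])
    qed
    moreover have "Poly_Mapping.lookup a x - Poly_Mapping.lookup b x \<le> Poly_Mapping.lookup u x" for x
      using ab(3)[of x] by simp
    moreover have "Poly_Mapping.lookup v x - Poly_Mapping.lookup u x = Poly_Mapping.lookup v x" for x
      using arg_cong[OF cop(2), of "\<lambda>p. Poly_Mapping.lookup p x"] by (simp add: lookup_minus)
    ultimately have "a - b = u" "b - a = v"
      using swap[OF reduce[OF ab(1,2)]] by (simp_all add: lookup_minus)
    then have eq: "Poly_Mapping.lookup a x - Poly_Mapping.lookup b x = Poly_Mapping.lookup u x"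
      "Poly_Mapping.lookup b x - Poly_Mapping.lookup a x = Poly_Mapping.lookup v x" for x
      by (auto simp: lookup_minus)
    \<comment> \<open>As \<open>a\<close> is at most \<open>u = a - b\<close>, the cancellation has
      removed nothing.\<close>
    have "Poly_Mapping.lookup a x = Poly_Mapping.lookup u x" "Poly_Mapping.lookup b x = Poly_Mapping.lookup v x" for x
      using eq[of x] ab(3)[of x] by auto
    then show ?thesis by (metis poly_mapping_eqI)
  qed
  have "minimal_generating_set ?R ?I G" if G: "graver_basis ?I G" for G
    unfolding minimal_generating_set_def
  proof (intro conjI allI impI)
    have prim: "primitive_binomial ?I f" if "f \<in> G" for f using G that by (simp add: graver_basis_def)
    then have "G \<subseteq> ?I" by (auto simp: primitive_binomial_def)
    moreover show GR: "G \<subseteq> carrier ?R" using \<open>G \<subseteq> ?I\<close> by (auto simp: monomial_kernel_def)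
    ultimately have "genideal ?R G \<subseteq> ?I" by (intro R.genideal_minimal ideal_monomial_kernel)
    moreover have "?I \<subseteq> genideal ?R G"
    proof (rule monomial_kernel_generated[OF X R.genideal_ideal[OF GR]])
      fix f assume f: "primitive_binomial ?I f"
      have "\<exists>!h. h \<in> G \<and> (h = f \<or> h = - f)" using G f unfolding graver_basis_def by blast
      then obtain h where h: "h \<in> G" "h = f \<or> h = - f" by blast
      interpret J: ideal "genideal ?R G" ?R by (rule R.genideal_ideal[OF GR])
      have "h \<in> genideal ?R G" using h(1) R.genideal_self[OF GR] by blast
      moreover have "- h \<in> genideal ?R G"
        using additive_subgroup.a_inv_closed[OF J.additive_subgroup_axioms calculation] a_inv_mpoly_ring[of h X] h(1) GR by auto
      ultimately show "f \<in> genideal ?R G" using h(2) by auto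
    qed
    ultimately show "genideal ?R G = ?I" by blast
    fix H assume "H \<subset> G"
    then obtain f where f: "f \<in> G" "f \<notin> H" "H \<subseteq> G" by blast
    from prim[OF f(1)] obtain u v where uv: "f \<in> ?I" "f \<noteq> 0" "f = monomial u - monomial v"
      "\<And>u' v'. \<lbrakk>monomial u' - monomial v' \<in> ?I; monomial u' - monomial v' \<noteq> (0 :: ('x, 'k) mpoly);
        monomial u' - monomial v' \<noteq> f; (monomial u' :: ('x, 'k) mpoly) dvd monomial u;
        (monomial v' :: ('x, 'k) mpoly) dvd monomial v\<rbrakk> \<Longrightarrow> False"
      unfolding primitive_binomial_def by blast
    have "u \<noteq> v" using uv(2,3) by auto
    have ind: "monomial a - monomial b = f" if "(monomial a - monomial b :: ('x, 'k) mpoly) \<in> ?I" "a \<noteq> b"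
        "\<And>x. Poly_Mapping.lookup a x \<le> Poly_Mapping.lookup u x" for a b
      unfolding uv(3)
    proof (rule indispensable[OF uv(1)[unfolded uv(3)] \<open>u \<noteq> v\<close> _ that])
      fix u' v'
      assume "(monomial u' - monomial v' :: ('x, 'k) mpoly) \<in> ?I" "u' \<noteq> v'"
        "\<And>x. Poly_Mapping.lookup u' x \<le> Poly_Mapping.lookup u x"
        "\<And>x. Poly_Mapping.lookup v' x \<le> Poly_Mapping.lookup v x"
      then show "monomial u' - monomial v' = (monomial u - monomial v :: ('x, 'k) mpoly)"
        using uv(4)[of u' v'] uv(3) by (auto simp: monomial_dvd_iff monomial_eq_iff)
    qed
    let ?J = "{p \<in> carrier ?R. \<forall>m. (\<forall>x. Poly_Mapping.lookup m x \<le> Poly_Mapping.lookup u x) \<longrightarrow>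
      Poly_Mapping.lookup p m = 0}"
    have "H \<subseteq> ?J"
    proof
      fix h assume "h \<in> H"
      then have "h \<in> G" "h \<noteq> f" using f by auto
      \<comment> \<open>\<open>G\<close> holds one representative of each pair. This matters because
        \<open>- f\<close> also has a term with exponent \<open>u\<close>.\<close>
      have "h \<noteq> - f"
        using G f(1) \<open>h \<in> G\<close> \<open>h \<noteq> f\<close> prim unfolding graver_basis_def by metis
      from prim[OF \<open>h \<in> G\<close>] obtain a b where h: "h \<in> ?I" "h \<noteq> 0" "h = monomial a - monomial b"
        unfolding primitive_binomial_def by blast
      have "a \<noteq> b" using h(2,3) by auto
      have "- h \<in> ?I" using h(1,3) \<open>a \<noteq> b\<close> by (auto simp: binomial_in_monomial_kernel)
      have "\<not> (\<forall>x. Poly_Mapping.lookup a x \<le> Poly_Mapping.lookup u x)"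
        using ind[of a b] h \<open>a \<noteq> b\<close> \<open>h \<noteq> f\<close> by blast
      moreover have "\<not> (\<forall>x. Poly_Mapping.lookup b x \<le> Poly_Mapping.lookup u x)"
        using ind[of b a] h \<open>a \<noteq> b\<close> \<open>h \<noteq> - f\<close> \<open>- h \<in> ?I\<close> by (metis minus_diff_eq minus_minus)
      moreover have "h \<in> carrier ?R" using h(1) by (simp add: monomial_kernel_def)
      ultimately show "h \<in> ?J"
        unfolding h(3) by (auto simp: lookup_minus monomial_def lookup_single when_def)
    qed
    then have "genideal ?R H \<subseteq> ?J" by (intro R.genideal_minimal ideal_no_divisors_of)
    moreover have "f \<notin> ?J"
    proof
      assume "f \<in> ?J"
      then have "Poly_Mapping.lookup f u = 0" by blast
      then show False using \<open>u \<noteq> v\<close> by (simp add: uv(3) lookup_minus monomial_def lookup_single when_def)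
    qed
    ultimately show "genideal ?R H \<noteq> ?I" using uv(1) by blast
  qed
  then show ?thesis unfolding strongly_robust_def by blast
qed

subsection \<open>Balanced edge labellings\<close>

text \<open>Symmetric labels on ordered pairs let the equation at \<open>x\<close> run over all
  neighbours, whatever the orientation; orientation and weights enter through
  \<open>\<alpha>\<close>, which need not be symmetric.\<close>

definition balanced :: "'v rel \<Rightarrow> ('v \<Rightarrow> 'v \<Rightarrow> int) \<Rightarrow> ('v \<Rightarrow> 'v \<Rightarrow> int) \<Rightarrow> bool" where
  "balanced S \<alpha> d \<longleftrightarrow> (\<forall>x y. d x y = d y x) \<and> (\<forall>x. (\<Sum>y\<in>S `` {x}. \<alpha> x y * d x y) = 0)"

text \<open>The partner edge is chosen after \<open>d\<close>, but its ratio holds against every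
  balanced \<open>d'\<close>, as the comparison of two labellings requires. Ratios are
  cross-multiplied to stay in the integers.\<close>

definition rigid :: "'v rel \<Rightarrow> ('v \<Rightarrow> 'v \<Rightarrow> int) \<Rightarrow> 'v \<Rightarrow> 'v \<Rightarrow> bool" where
  "rigid S \<alpha> x y \<longleftrightarrow> (\<forall>d. balanced S \<alpha> d \<longrightarrow> d x y \<noteq> 0 \<longrightarrow>
     (\<exists>x' y'. (x', y') \<in> S \<and> d x y * d x' y' < 0 \<and>
        (\<forall>d'. balanced S \<alpha> d' \<longrightarrow> d x y * d' x' y' = d x' y' * d' x y)))"

lemma balanced_vertex: "balanced S \<alpha> d \<Longrightarrow> (\<Sum>y\<in>S `` {x}. \<alpha> x y * d x y) = 0"
  unfolding balanced_def by blast

lemma balanced_commute: "balanced S \<alpha> d \<Longrightarrow> d x y = d y x"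
  unfolding balanced_def by blast

lemma rigid_sym:
  assumes "rigid S \<alpha> x y"
  shows "rigid S \<alpha> y x"
  unfolding rigid_def
proof (intro allI impI)
  fix d assume d: "balanced S \<alpha> d" "d y x \<noteq> 0"
  have eq: "d y x = d x y" by (rule balanced_commute[OF d(1)])
  with assms d obtain x' y' where xy': "(x', y') \<in> S" "d x y * d x' y' < 0"
    "\<And>d'. balanced S \<alpha> d' \<Longrightarrow> d x y * d' x' y' = d x' y' * d' x y"
    unfolding rigid_def by metis
  have "d y x * d' x' y' = d x' y' * d' y x" if "balanced S \<alpha> d'" for d'
    unfolding eq balanced_commute[OF that, of y x] by (rule xy'(3)[OF that])
  then show "\<exists>x' y'. (x', y') \<in> S \<and> d y x * d x' y' < 0 \<and>
      (\<forall>d'. balanced S \<alpha> d' \<longrightarrow> d y x * d' x' y' = d x' y' * d' y x)"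
    using xy'(1,2) eq by metis
qed

text \<open>Both pairs lie on the line spanned by \<open>(q, - p)\<close>, whose coordinates have
  opposite signs.\<close>

lemma two_term_ratio:
  fixes p q :: int
  assumes "0 < p" "0 < q" "p * a + q * b = 0" "p * a' + q * b' = 0"
  shows "a * b' = b * a'" "a \<noteq> 0 \<Longrightarrow> a * b < 0"
proof -
  have qb: "q * b = - (p * a)" "q * b' = - (p * a')" using assms by auto
  have "q * (a * b') = a * (q * b')" by simp
  also have "\<dots> = (q * b) * a'" unfolding qb by simp
  finally show "a * b' = b * a'" using assms(2) by simp
  assume "a \<noteq> 0"
  have "q * (a * b) = a * (q * b)" by simp
  also have "\<dots> = - (p * (a * a))" unfolding qb by simp
  also have "\<dots> < 0" using assms(1) \<open>a \<noteq> 0\<close> by (simp add: zero_less_mult_iff) linarith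
  finally show "a * b < 0" using assms(2) by (simp add: mult_less_0_iff)
qed

text \<open>The equation at \<open>x\<close> has only two terms, so the edge to \<open>z\<close> is
  the partner of the edge to \<open>y\<close>.\<close>

lemma rigid_degree_two:
  assumes nbrs: "S `` {x} = {y, z}" "y \<noteq> z" and pos: "\<And>x y. (x, y) \<in> S \<Longrightarrow> 0 < \<alpha> x y"
  shows "rigid S \<alpha> x y"
  unfolding rigid_def
proof (intro allI impI)
  fix d assume d: "balanced S \<alpha> d" "d x y \<noteq> 0"
  have yz: "(x, y) \<in> S" "(x, z) \<in> S" using nbrs by auto
  have eq: "\<alpha> x y * d x y + \<alpha> x z * d x z = 0" if "balanced S \<alpha> d" for d
  proof -
    have "(\<Sum>y\<in>S `` {x}. \<alpha> x y * d x y) = 0" using that by (rule balanced_vertex)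
    then show ?thesis unfolding nbrs(1) using nbrs(2) by simp
  qed
  show "\<exists>x' y'. (x', y') \<in> S \<and> d x y * d x' y' < 0 \<and>
        (\<forall>d'. balanced S \<alpha> d' \<longrightarrow> d x y * d' x' y' = d x' y' * d' x y)"
    using two_term_ratio[OF pos[OF yz(1)] pos[OF yz(2)] eq[OF d(1)] eq] yz(2) d(2) d(1) by blast
qed

text \<open>
  This covers a path of length one from \<open>v\<close>, whose edge has no endpoint of degree two: the labels along
  the cycle are in a fixed ratio to each other, so the equation at \<open>c 0\<close> relates the label of the
  pendant edge to one label of the cycle.
\<close>

lemma rigid_pendant:
  assumes n: "3 \<le> n" and inj: "inj_on c {..<n}" and v: "v \<notin> c ` {..<n}"
    and base: "S `` {c 0} = {v, c 1, c (n - 1)}"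
    and nbrs: "\<And>s. Suc s < n \<Longrightarrow> S `` {c (Suc s)} = {c s, c (Suc (Suc s) mod n)}"
    and pos: "\<And>x y. (x, y) \<in> S \<Longrightarrow> 0 < \<alpha> x y"
  shows "rigid S \<alpha> (c 0) v"
  unfolding rigid_def
proof (intro allI impI)
  define f where "f d s = d (c s) (c (Suc s mod n))" for d :: "'a \<Rightarrow> 'a \<Rightarrow> int" and s
  have c_neq: "c s \<noteq> c t" if "s < n" "t < n" "s \<noteq> t" for s t
    using that inj_on_contraD[OF inj that(3)] by simp
  have step: "\<exists>p q. 0 < p \<and> 0 < q \<and> (\<forall>d. balanced S \<alpha> d \<longrightarrow> p * f d s + q * f d (Suc s) = 0)"
    if s: "Suc s < n" for s
  proof (intro exI conjI allI impI)
    let ?x = "c (Suc s)" and ?z = "c (Suc (Suc s) mod n)"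
    show "0 < \<alpha> ?x (c s)" "0 < \<alpha> ?x ?z" using nbrs[OF s] by (auto intro!: pos)
    fix d assume d: "balanced S \<alpha> d"
    have "Suc (Suc s) mod n \<noteq> s" "Suc (Suc s) mod n < n"
      using s n by (auto simp: mod_Suc)
    then have "c s \<noteq> ?z" using c_neq[of s "Suc (Suc s) mod n"] s by auto
    moreover have "(\<Sum>y\<in>S `` {?x}. \<alpha> ?x y * d ?x y) = 0" using d by (rule balanced_vertex)
    ultimately have "\<alpha> ?x (c s) * d ?x (c s) + \<alpha> ?x ?z * d ?x ?z = 0" unfolding nbrs[OF s] by simp
    moreover have "d ?x (c s) = d (c s) ?x" using d by (rule balanced_commute)
    ultimately show "\<alpha> ?x (c s) * f d s + \<alpha> ?x ?z * f d (Suc s) = 0"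
      using s by (simp add: f_def)
  qed
  \<comment> \<open>The two-term equations are chained along the cycle; each step reverses the sign
    of the ratio \<open>p / q\<close>, and only \<open>q\<close> is kept positive.\<close>
  have ratio: "\<exists>p q. 0 < q \<and> (\<forall>d. balanced S \<alpha> d \<longrightarrow> q * f d s = p * f d 0)" if "s < n" for s
    using that
  proof (induction s)
    case 0
    show ?case by (intro exI[of _ 1]) simp
  next
    case (Suc s)
    then obtain p q where q: "0 < q" "\<And>d. balanced S \<alpha> d \<Longrightarrow> q * f d s = p * f d 0" by fastforce
    from step[OF Suc.prems] obtain p' q' where q': "0 < q'"
      "\<And>d. balanced S \<alpha> d \<Longrightarrow> p' * f d s + q' * f d (Suc s) = 0" by blast
    have "q * q' * f d (Suc s) = - p' * p * f d 0" if "balanced S \<alpha> d" for d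
    proof -
      have "q * q' * f d (Suc s) = q * (q' * f d (Suc s))" by simp
      also have "\<dots> = q * (- (p' * f d s))" using q'(2)[OF that] by (metis add.commute eq_neg_iff_add_eq_0)
      also have "\<dots> = - p' * (q * f d s)" by simp
      finally show ?thesis using q(2)[OF that] by simp
    qed
    then show ?case using q(1) q'(1) by (metis mult_pos_pos)
  qed
  \<comment> \<open>The equation at \<open>c 0\<close> has three terms; expressing
    \<open>f d (n - 1)\<close> through \<open>f d 0\<close> leaves the pendant label as a rational
    multiple of \<open>f d 0\<close>. The sign of \<open>Q\<close> depends on \<open>n\<close> and
    on the coefficients.\<close>
  obtain P Q where PQ: "0 < P" "\<And>d. balanced S \<alpha> d \<Longrightarrow> P * d (c 0) v = Q * f d 0"
  proof -
    have "n - 1 < n" using n by simp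
    from ratio[OF this] obtain p q where q: "0 < q"
      "\<And>d. balanced S \<alpha> d \<Longrightarrow> q * f d (n - 1) = p * f d 0" by blast
    let ?u = "c 0" and ?z = "c (n - 1)"
    have "q * \<alpha> ?u v * d ?u v = - (q * \<alpha> ?u (c 1) + \<alpha> ?u ?z * p) * f d 0" if d: "balanced S \<alpha> d" for d
    proof -
      have "c 1 \<noteq> ?z" "v \<noteq> c 1" "v \<noteq> ?z" using n v c_neq[of 1 "n - 1"] by auto
      moreover have "(\<Sum>y\<in>S `` {?u}. \<alpha> ?u y * d ?u y) = 0" using d by (rule balanced_vertex)
      ultimately have "\<alpha> ?u v * d ?u v + (\<alpha> ?u (c 1) * d ?u (c 1) + \<alpha> ?u ?z * d ?u ?z) = 0"
        unfolding base by simp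
      moreover have "d ?u ?z = f d (n - 1)" "d ?u (c 1) = f d 0"
        using n balanced_commute[OF d, of ?u ?z] by (simp_all add: f_def)
      ultimately have eq: "\<alpha> ?u v * d ?u v = - (\<alpha> ?u (c 1) * f d 0) - \<alpha> ?u ?z * f d (n - 1)" by simp
      have "q * \<alpha> ?u v * d ?u v = q * (\<alpha> ?u v * d ?u v)" by simp
      also have "\<dots> = - (q * \<alpha> ?u (c 1)) * f d 0 - \<alpha> ?u ?z * (q * f d (n - 1))"
        unfolding eq by (simp add: algebra_simps)
      also have "\<dots> = - (q * \<alpha> ?u (c 1) + \<alpha> ?u ?z * p) * f d 0"
        unfolding q(2)[OF d] by (simp add: algebra_simps)
      finally show ?thesis .
    qed
    moreover have "0 < q * \<alpha> ?u v" using q(1) base by (auto intro!: mult_pos_pos pos)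
    ultimately show ?thesis using that by blast
  qed
  fix d assume d: "balanced S \<alpha> d" "d (c 0) v \<noteq> 0"
  have f0: "f d 0 \<noteq> 0" using PQ(1) PQ(2)[OF d(1)] d(2) by auto
  have cross0: "d (c 0) v * f d' 0 = f d 0 * d' (c 0) v" if d': "balanced S \<alpha> d'" for d'
  proof -
    have "P * (d (c 0) v * f d' 0) = (P * d (c 0) v) * f d' 0" by simp
    also have "\<dots> = f d 0 * (P * d' (c 0) v)" unfolding PQ(2)[OF d(1)] PQ(2)[OF d'] by simp
    finally show ?thesis using PQ(1) by simp
  qed
  from step[of 0] n obtain p q where pq: "0 < p" "0 < q"
    "\<And>d. balanced S \<alpha> d \<Longrightarrow> p * f d 0 + q * f d 1 = 0" by auto
  have opp: "f d 0 * f d 1 < 0" using two_term_ratio(2)[OF pq(1,2) pq(3)[OF d(1)] pq(3)[OF d(1)] f0] .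
  have cross1: "d (c 0) v * f d' 1 = f d 1 * d' (c 0) v" if d': "balanced S \<alpha> d'" for d'
  proof -
    have "f d 0 * (d (c 0) v * f d' 1) = d (c 0) v * (f d 0 * f d' 1)" by simp
    also have "\<dots> = f d 1 * (d (c 0) v * f d' 0)"
      using two_term_ratio(1)[OF pq(1,2) pq(3)[OF d(1)] pq(3)[OF d']] by simp
    also have "\<dots> = f d 0 * (f d 1 * d' (c 0) v)" unfolding cross0[OF d'] by simp
    finally show ?thesis using f0 by simp
  qed
  have S: "(c 0, c (Suc 0 mod n)) \<in> S" "(c 1, c (Suc 1 mod n)) \<in> S"
    using base nbrs[of 0] n by auto
  \<comment> \<open>Whatever the sign of \<open>Q\<close>, one of two consecutive cycle labels is
    opposite to the pendant label.\<close>
  have "d (c 0) v * f d 0 < 0 \<or> d (c 0) v * f d 1 < 0"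
    using opp d(2) f0 by (simp add: mult_less_0_iff) linarith
  then show "\<exists>x' y'. (x', y') \<in> S \<and> d (c 0) v * d x' y' < 0 \<and>
        (\<forall>d'. balanced S \<alpha> d' \<longrightarrow> d (c 0) v * d' x' y' = d x' y' * d' (c 0) v)"
    using S cross0 cross1 unfolding f_def by blast
qed

section \<open>Binomials of the toric ideal as balanced labellings\<close>

definition edge_exp :: "('v \<Rightarrow> nat) \<Rightarrow> 'v \<times> 'v \<Rightarrow> ('v \<Rightarrow>\<^sub>0 nat)" where
  "edge_exp w e = Poly_Mapping.single (fst e) 1 + Poly_Mapping.single (snd e) (w (snd e))"

lemma toric_ideal_eq_monomial_kernel:
  fixes G :: "'v pair_pre_digraph"
  shows "(toric_ideal G w :: ('v \<times> 'v, 'k::field) mpoly set) = monomial_kernel (parcs G) (edge_exp w)"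
proof -
  have "(monomial m :: ('v, 'k::field) mpoly) ^ n = monomial (\<Sum>i<n. m)" for m :: "'v \<Rightarrow>\<^sub>0 nat" and n
    using monomial_sum[of "\<lambda>_. m" "{..<n}"] by simp
  moreover have "(\<Sum>i<n. Poly_Mapping.single y 1) = (Poly_Mapping.single y n :: 'v \<Rightarrow>\<^sub>0 nat)" for y :: 'v and n
    by (induction n) (simp_all add: single_add[symmetric] add.commute)
  ultimately have "toric_map w = (mpoly_subst (\<lambda>x. monomial (edge_exp w x)) :: ('v \<times> 'v, 'k) mpoly \<Rightarrow> _)"
    unfolding toric_map_def by (intro arg_cong[of _ _ mpoly_subst])
      (auto simp: fun_eq_iff var_def edge_exp_def monomial_mult)
  then show ?thesis
    by (auto simp: toric_ideal_def monomial_kernel_def a_kernel_def kernel_def mpoly_ring_def)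
qed

text \<open>
  Undirected edges are represented by both orientations: \<open>edge_coeff E w x y\<close> is the exponent of
  \<open>x\<close> in the image of the edge \<open>{x, y}\<close>.
\<close>

definition edge_coeff :: "'v rel \<Rightarrow> ('v \<Rightarrow> nat) \<Rightarrow> 'v \<Rightarrow> 'v \<Rightarrow> int" where
  "edge_coeff E w x y = (if (x, y) \<in> E then 1 else int (w x))"

text \<open>The arc carrying the undirected edge is selected first, which makes the value symmetric
  when \<open>E\<close> is antisymmetric. For a non-edge the lookup falls on \<open>(y, x)\<close>,
  where exponents supported in \<open>E\<close> vanish.\<close>

definition edge_diff ::
    "'v rel \<Rightarrow> ('v \<times> 'v \<Rightarrow>\<^sub>0 nat) \<Rightarrow> ('v \<times> 'v \<Rightarrow>\<^sub>0 nat) \<Rightarrow> 'v \<Rightarrow> 'v \<Rightarrow> int" where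
  "edge_diff E u v x y = int (Poly_Mapping.lookup u (if (x, y) \<in> E then (x, y) else (y, x)))
     - int (Poly_Mapping.lookup v (if (x, y) \<in> E then (x, y) else (y, x)))"

context
  fixes E :: "'v rel" and w :: "'v \<Rightarrow> nat"
  assumes fin: "finite E" and anti: "antisym E" and irr: "\<And>x. (x, x) \<notin> E"
begin

text \<open>The sum at \<open>x\<close> is the difference of the exponents of \<open>x\<close> in
  the images of the two terms. Arcs leaving \<open>x\<close> contribute with factor 1, arcs entering
  it with \<open>w x\<close>; without loops and opposite arcs the two sets of neighbours are
  disjoint.\<close>

lemma balanced_edge_diff:
  assumes "Poly_Mapping.keys u \<subseteq> E" "Poly_Mapping.keys v \<subseteq> E" "exp_map (edge_exp w) u = exp_map (edge_exp w) v"
  shows "balanced (E \<union> E\<inverse>) (edge_coeff E w) (edge_diff E u v)"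
  unfolding balanced_def
proof (intro conjI allI)
  fix x y
  have "Poly_Mapping.lookup u e = 0 \<and> Poly_Mapping.lookup v e = 0" if "e \<notin> E" for e
    using assms(1,2) that by (auto simp: in_keys_iff)
  then show "edge_diff E u v x y = edge_diff E u v y x"
    using anti by (auto simp: edge_diff_def dest: antisymD)
next
  fix x
  define d where "d e = int (Poly_Mapping.lookup u e) - int (Poly_Mapping.lookup v e)" for e
  have "int (Poly_Mapping.lookup (exp_map (edge_exp w) u) x) - int (Poly_Mapping.lookup (exp_map (edge_exp w) v) x) =
      (\<Sum>e\<in>E. d e * int (Poly_Mapping.lookup (edge_exp w e) x))"
    using assms(1,2) fin
    by (simp add: lookup_exp_map d_def left_diff_distrib sum_subtractf)
  also have "\<dots> = (\<Sum>e\<in>E. if fst e = x then d e else 0) + (\<Sum>e\<in>E. if snd e = x then d e * int (w x) else 0)"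
    by (subst sum.distrib[symmetric], rule sum.cong)
      (auto simp: edge_exp_def lookup_add lookup_single when_def distrib_left)
  also have "(\<Sum>e\<in>E. if fst e = x then d e else 0) = (\<Sum>e\<in>{e\<in>E. fst e = x}. d e)"
    using fin by (simp add: sum.inter_filter)
  also have "\<dots> = (\<Sum>y\<in>E `` {x}. d (x, y))"
    by (rule sum.reindex_bij_witness[of _ "\<lambda>y. (x, y)" snd]) auto
  also have "(\<Sum>e\<in>E. if snd e = x then d e * int (w x) else 0) = (\<Sum>e\<in>{e\<in>E. snd e = x}. d e * int (w x))"
    using fin by (simp add: sum.inter_filter)
  also have "\<dots> = (\<Sum>y\<in>E\<inverse> `` {x}. d (y, x) * int (w x))"
    by (rule sum.reindex_bij_witness[of _ "\<lambda>y. (y, x)" fst]) auto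
  also have "(\<Sum>y\<in>E `` {x}. d (x, y)) = (\<Sum>y\<in>E `` {x}. edge_coeff E w x y * edge_diff E u v x y)"
    by (rule sum.cong) (auto simp: edge_coeff_def edge_diff_def d_def)
  also have "(\<Sum>y\<in>E\<inverse> `` {x}. d (y, x) * int (w x)) = (\<Sum>y\<in>E\<inverse> `` {x}. edge_coeff E w x y * edge_diff E u v x y)"
    using anti irr by (intro sum.cong) (auto simp: edge_coeff_def edge_diff_def d_def dest: antisymD)
  also have "(\<Sum>y\<in>E `` {x}. edge_coeff E w x y * edge_diff E u v x y) + (\<Sum>y\<in>E\<inverse> `` {x}. edge_coeff E w x y * edge_diff E u v x y)
      = (\<Sum>y\<in>(E \<union> E\<inverse>) `` {x}. edge_coeff E w x y * edge_diff E u v x y)"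
    unfolding Un_Image using fin anti irr
    by (intro sum.union_disjoint[symmetric]) (auto dest: antisymD intro: finite_Image)
  finally show "(\<Sum>y\<in>(E \<union> E\<inverse>) `` {x}. edge_coeff E w x y * edge_diff E u v x y) = 0"
    using assms(3) by simp
qed

text \<open>\<open>rigid\<close> is applied with \<open>a - b\<close> as the chosen labelling and
  \<open>u - v\<close> as the one compared with it. Where \<open>b\<close> does not exceed
  \<open>a\<close>, truncated subtraction makes the claim trivial.\<close>

lemma strongly_robust_if_rigid:
  assumes rigid: "\<And>x y. (x, y) \<in> E \<Longrightarrow> rigid (E \<union> E\<inverse>) (edge_coeff E w) x y"
  shows "strongly_robust (mpoly_ring E) (monomial_kernel E (edge_exp w) :: ('v \<times> 'v, 'k::field) mpoly set)"
proof (rule strongly_robust_monomial_kernel[OF fin])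
  fix u v a b :: "'v \<times> 'v \<Rightarrow>\<^sub>0 nat" and e :: "'v \<times> 'v"
  assume k: "Poly_Mapping.keys u \<subseteq> E" "Poly_Mapping.keys v \<subseteq> E"
    "Poly_Mapping.keys a \<subseteq> E" "Poly_Mapping.keys b \<subseteq> E"
    "exp_map (edge_exp w) u = exp_map (edge_exp w) v" "exp_map (edge_exp w) a = exp_map (edge_exp w) b"
    and le: "\<And>x. Poly_Mapping.lookup a x - Poly_Mapping.lookup b x
           \<le> Poly_Mapping.lookup u x - Poly_Mapping.lookup v x"
  let ?d = "edge_diff E a b" and ?D = "edge_diff E u v"
  have bal: "balanced (E \<union> E\<inverse>) (edge_coeff E w) ?d" "balanced (E \<union> E\<inverse>) (edge_coeff E w) ?D"
    using balanced_edge_diff k by blast+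
  show "Poly_Mapping.lookup b e - Poly_Mapping.lookup a e \<le> Poly_Mapping.lookup v e - Poly_Mapping.lookup u e"
  proof (cases "Poly_Mapping.lookup a e < Poly_Mapping.lookup b e")
    case True
    obtain x y where e: "e = (x, y)" by fastforce
    have "(x, y) \<in> E" using k(4) True e by (auto simp: in_keys_iff)
    then have de: "?d x y = int (Poly_Mapping.lookup a e) - int (Poly_Mapping.lookup b e)"
      "?D x y = int (Poly_Mapping.lookup u e) - int (Poly_Mapping.lookup v e)"
      by (simp_all add: edge_diff_def e)
    have neg: "?d x y < 0" using True de by simp
    with rigid[OF \<open>(x, y) \<in> E\<close>] bal obtain x' y' where xy': "(x', y') \<in> E \<union> E\<inverse>"
      "?d x y * ?d x' y' < 0" "?d x y * ?D x' y' = ?d x' y' * ?D x y"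
      unfolding rigid_def by (metis less_irrefl)
    from xy'(2) neg have pos: "0 < ?d x' y'" by (simp add: mult_less_0_iff)
    let ?e = "if (x', y') \<in> E then (x', y') else (y', x')"
    have "?d x' y' = int (Poly_Mapping.lookup a ?e) - int (Poly_Mapping.lookup b ?e)"
      "?D x' y' = int (Poly_Mapping.lookup u ?e) - int (Poly_Mapping.lookup v ?e)"
      by (simp_all add: edge_diff_def)
    with pos le[of ?e] have "?d x' y' \<le> ?D x' y'" by linarith
    then have "?d x y * ?D x' y' \<le> ?d x y * ?d x' y'" using neg by (intro mult_left_mono_neg) auto
    then have "?d x' y' * ?D x y \<le> ?d x' y' * ?d x y" using xy'(3) by (simp add: mult.commute)
    then have "?D x y \<le> ?d x y" using pos by simp
    then show ?thesis using de by linarith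
  qed simp
qed

end

subsection \<open>Cycles and paths in the underlying graph\<close>

lemma parcs_underlying: "parcs (underlying H) = parcs H \<union> (parcs H)\<inverse>"
  by (auto simp: parcs_mk_symmetric)

lemma length_pawalk_verts: "length (pawalk_verts u p) = Suc (length p)"
  by (induction p arbitrary: u) simp_all

lemma pawalk_verts_nth_0: "pcas u p w \<Longrightarrow> pawalk_verts u p ! 0 = u"
  by (cases p) auto

lemma pawalk_verts_nth_length: "pcas u p w \<Longrightarrow> pawalk_verts u p ! length p = w"
  by (induction p arbitrary: u) auto

lemma nth_eq_pawalk_verts:
  "pcas u p w \<Longrightarrow> s < length p \<Longrightarrow> p ! s = (pawalk_verts u p ! s, pawalk_verts u p ! Suc s)"
proof (induction p arbitrary: u s)
  case (Cons e p)
  then show ?case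
    using pawalk_verts_nth_0[of "snd e" p w] by (cases s) (auto simp: prod_eq_iff)
qed simp

text \<open>Indices modulo \<open>n\<close> give the cycle a movable base point;
  \<open>3 \<le> n\<close> keeps the two neighbours of a vertex distinct.\<close>

definition cyclic_enum :: "(nat \<Rightarrow> 'v) \<Rightarrow> nat \<Rightarrow> 'v set \<Rightarrow> 'v rel \<Rightarrow> bool" where
  "cyclic_enum c n V U \<longleftrightarrow> 3 \<le> n \<and> inj_on c {..<n} \<and> V = c ` {..<n} \<and>
     U = (\<Union>s<n. {(c s, c (Suc s mod n)), (c (Suc s mod n), c s)})"

text \<open>\<open>m\<close> counts edges, so \<open>m = 0\<close> is a single vertex.\<close>

definition path_enum :: "(nat \<Rightarrow> 'v) \<Rightarrow> nat \<Rightarrow> 'v set \<Rightarrow> 'v rel \<Rightarrow> bool" where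
  "path_enum q m V U \<longleftrightarrow> inj_on q {..m} \<and> V = q ` {..m} \<and>
     U = (\<Union>s<m. {(q s, q (Suc s)), (q (Suc s), q s)})"

lemma set_arcs_conv_nth:
  assumes "\<And>s. s < length p \<Longrightarrow> p ! s = (f s, g s)"
  shows "set p \<union> (set p)\<inverse> = (\<Union>s<length p. {(f s, g s), (g s, f s)})"
proof -
  have "set p = (\<lambda>s. p ! s) ` {..<length p}" by (auto simp: set_conv_nth)
  also have "\<dots> = (\<lambda>s. (f s, g s)) ` {..<length p}" using assms by (intro image_cong) auto
  finally have "set p = (\<lambda>s. (f s, g s)) ` {..<length p}" .
  then show ?thesis by auto
qed

lemma path_graph_enum:
  assumes "path_graph a H b"
  obtains q m where "path_enum q m (pverts H) (parcs (underlying H))" "q 0 = a" "q m = b"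
proof -
  from assms obtain p where p: "pcas a p b" "distinct (pawalk_verts a p)"
    "pverts H = set (pawalk_verts a p)" "parcs (underlying H) = set p \<union> (set p)\<inverse>"
    unfolding path_graph_def pre_digraph.apath_def pre_digraph.awalk_def
      cas_with_proj_eq awalk_verts_with_proj_eq by blast
  let ?q = "\<lambda>s. pawalk_verts a p ! s"
  have len: "{..length p} = {..<length (pawalk_verts a p)}" by (auto simp: length_pawalk_verts)
  show thesis
  proof
    show "path_enum ?q (length p) (pverts H) (parcs (underlying H))"
      unfolding path_enum_def p(3,4) len
    proof (intro conjI)
      show "inj_on ?q {..<length (pawalk_verts a p)}" using p(2) by (auto intro: inj_on_nth)
      show "set (pawalk_verts a p) = ?q ` {..<length (pawalk_verts a p)}"
        by (auto simp: set_conv_nth)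
      show "set p \<union> (set p)\<inverse> = (\<Union>s<length p. {(?q s, ?q (Suc s)), (?q (Suc s), ?q s)})"
        by (rule set_arcs_conv_nth) (rule nth_eq_pawalk_verts[OF p(1)])
    qed
  qed (use p(1) pawalk_verts_nth_0 pawalk_verts_nth_length in metis)+
qed

lemma cycle_graph_enum:
  assumes "cycle_graph H"
  obtains c n where "cyclic_enum c n (pverts H) (parcs (underlying H))"
proof -
  from assms obtain p where cyc: "pre_digraph.cycle (with_proj (underlying H)) p" and p: "3 \<le> length p"
    "pverts H = fst ` set p" "parcs (underlying H) = set p \<union> (set p)\<inverse>"
    unfolding cycle_graph_def by (elim exE conjE) (rule that)
  from cyc obtain u where u: "pcas u p u" "distinct (tl (pawalk_verts u p))"
    unfolding pre_digraph.cycle_def pre_digraph.awalk_def cas_with_proj_eq awalk_verts_with_proj_eq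
    by (elim exE conjE) (rule that)
  define vs where "vs = pawalk_verts u p"
  let ?n = "length p"
  have vs: "length vs = Suc ?n" "vs ! 0 = u" "vs ! ?n = u"
    unfolding vs_def using u(1) by (auto simp: length_pawalk_verts pawalk_verts_nth_0 pawalk_verts_nth_length)
  have nth: "p ! s = (vs ! s, vs ! (Suc s mod ?n))" if "s < ?n" for s
    using nth_eq_pawalk_verts[OF u(1) that] vs(2,3) that
    by (cases "Suc s = ?n") (simp_all add: vs_def)
  show thesis
  proof (rule that)
    show "cyclic_enum (\<lambda>s. vs ! s) ?n (pverts H) (parcs (underlying H))"
      unfolding cyclic_enum_def p(2,3)
    proof (intro conjI p(1))
      show "inj_on (\<lambda>s. vs ! s) {..<?n}"
      proof (rule inj_onI)
        fix s t assume st: "s \<in> {..<?n}" "t \<in> {..<?n}" "vs ! s = vs ! t"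
        \<comment> \<open>Distinctness is known only for the tail of the vertex list. There the
          start vertex appears as the last entry, so index 0 is sent to \<open>?n - 1\<close> and
          every other index drops by one.\<close>
        define r where "r s = (if s = 0 then ?n - 1 else s - 1)" for s
        have r: "vs ! s = tl vs ! r s" "r s < length (tl vs)" if "s < ?n" for s
          using that vs by (auto simp: r_def nth_tl)
        have "r s = r t"
          using st r[of s] r[of t] u(2) by (simp add: vs_def nth_eq_iff_index_eq)
        then show "s = t" using st by (auto simp: r_def split: if_splits)
      qed
      show "fst ` set p = (\<lambda>s. vs ! s) ` {..<?n}"
        using nth by (force simp: set_conv_nth image_iff)
      show "set p \<union> (set p)\<inverse> =
          (\<Union>s<?n. {(vs ! s, vs ! (Suc s mod ?n)), (vs ! (Suc s mod ?n), vs ! s)})"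
        by (rule set_arcs_conv_nth) (rule nth)
    qed
  qed
qed

text \<open>Any vertex may serve as \<open>c 0\<close>, such as the one where a path meets its
  cycle. The index shift is injective because it is surjective on a finite set.\<close>

lemma cyclic_enum_rotate:
  assumes "cyclic_enum c n V U" "r \<in> V"
  obtains c' where "cyclic_enum c' n V U" "c' 0 = r"
proof -
  from assms have n: "3 \<le> n" and inj: "inj_on c {..<n}" and V: "V = c ` {..<n}"
    and U: "U = (\<Union>s<n. {(c s, c (Suc s mod n)), (c (Suc s mod n), c s)})"
    by (auto simp: cyclic_enum_def)
  from assms(2) V obtain k where k: "k < n" "c k = r" by auto
  define \<rho> where "\<rho> s = (s + k) mod n" for s
  have surj: "\<rho> ` {..<n} = {..<n}"
  proof
    show "{..<n} \<subseteq> \<rho> ` {..<n}"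
    proof
      fix s assume "s \<in> {..<n}"
      then have "s = \<rho> ((s + (n - k)) mod n)"
        using k(1) by (simp add: \<rho>_def mod_simps)
      then show "s \<in> \<rho> ` {..<n}" using n by (intro image_eqI) auto
    qed
  qed (use n in \<open>auto simp: \<rho>_def\<close>)
  then have inj\<rho>: "inj_on \<rho> {..<n}" by (intro eq_card_imp_inj_on) auto
  have Suc\<rho>: "Suc (\<rho> s) mod n = \<rho> (Suc s mod n)" for s by (simp add: \<rho>_def mod_simps)
  show thesis
  proof
    show "cyclic_enum (c \<circ> \<rho>) n V U"
      unfolding cyclic_enum_def
    proof (intro conjI n)
      show "inj_on (c \<circ> \<rho>) {..<n}" using inj\<rho> inj surj by (simp add: comp_inj_on)
      show "V = (c \<circ> \<rho>) ` {..<n}" unfolding V image_comp[symmetric] surj ..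
      have "U = (\<Union>s\<in>\<rho> ` {..<n}. {(c s, c (Suc s mod n)), (c (Suc s mod n), c s)})"
        unfolding U surj ..
      then show "U = (\<Union>s<n. {((c \<circ> \<rho>) s, (c \<circ> \<rho>) (Suc s mod n)), ((c \<circ> \<rho>) (Suc s mod n), (c \<circ> \<rho>) s)})"
        by (simp add: Suc\<rho>)
    qed
    show "(c \<circ> \<rho>) 0 = r" using k by (simp add: \<rho>_def)
  qed
qed

lemma cyclic_enum_Image:
  assumes "cyclic_enum c n V U" "s < n"
  shows "U `` {c s} = {c (if s = 0 then n - 1 else s - 1), c (Suc s mod n)}"
proof -
  from assms have n: "3 \<le> n" and inj: "inj_on c {..<n}"
    and U: "U = (\<Union>s<n. {(c s, c (Suc s mod n)), (c (Suc s mod n), c s)})"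
    by (auto simp: cyclic_enum_def)
  have mod: "Suc t mod n < n" for t using n by simp
  have eq: "c s = c t \<longleftrightarrow> s = t" if "t < n" for t
    using inj that assms(2) by (auto dest: inj_onD)
  have prev: "s = Suc t mod n \<longleftrightarrow> t = (if s = 0 then n - 1 else s - 1)" if "t < n" for t
    using that assms(2) n by (auto simp: mod_Suc)
  show ?thesis
  proof (intro equalityI subsetI)
    fix y assume "y \<in> U `` {c s}"
    then obtain t where t: "t < n" "c s = c t \<and> y = c (Suc t mod n) \<or> c s = c (Suc t mod n) \<and> y = c t"
      unfolding U by auto
    from t(2) show "y \<in> {c (if s = 0 then n - 1 else s - 1), c (Suc s mod n)}"
    proof
      assume "c s = c t \<and> y = c (Suc t mod n)"
      then show ?thesis using eq[OF t(1)] by blast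
    next
      assume y: "c s = c (Suc t mod n) \<and> y = c t"
      then have "s = Suc t mod n" using eq[OF mod[of t]] by blast
      then have "t = (if s = 0 then n - 1 else s - 1)" using prev[OF t(1)] by blast
      then show ?thesis using y by blast
    qed
  next
    fix y assume "y \<in> {c (if s = 0 then n - 1 else s - 1), c (Suc s mod n)}"
    moreover have "(c s, c (if s = 0 then n - 1 else s - 1)) \<in> U"
    proof -
      let ?t = "if s = 0 then n - 1 else s - 1"
      have "?t < n" using n assms(2) by (cases s) auto
      then have s: "s = Suc ?t mod n" using prev by blast
      have "(c (Suc ?t mod n), c ?t) \<in> U" unfolding U using \<open>?t < n\<close> by blast
      then show ?thesis by (simp only: s[symmetric])
    qed
    moreover have "(c s, c (Suc s mod n)) \<in> U" unfolding U using assms(2) by blast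
    ultimately show "y \<in> U `` {c s}" by blast
  qed
qed

lemma cyclic_enum_connected:
  assumes "cyclic_enum c n V U" "x \<in> V" "y \<in> V"
  shows "(x, y) \<in> U\<^sup>*"
proof -
  from assms have V: "V = c ` {..<n}"
    and U: "U = (\<Union>s<n. {(c s, c (Suc s mod n)), (c (Suc s mod n), c s)})"
    by (auto simp: cyclic_enum_def)
  have from0: "(c 0, c s) \<in> U\<^sup>*" if "s < n" for s
    using that
  proof (induction s)
    case (Suc s)
    then have "(c s, c (Suc s)) \<in> U" unfolding U by (auto intro!: bexI[of _ s])
    with Suc show ?case by (simp add: rtrancl_into_rtrancl)
  qed simp
  have "sym U" unfolding U by (auto simp: sym_def)
  then have "sym (U\<^sup>*)" by (rule sym_rtrancl)
  then show ?thesis using from0 assms(2,3) V by (metis imageE lessThan_iff rtrancl_trans symD)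
qed

section \<open>Closing a path to a cycle\<close>

lemma rtrancl_distinct_list:
  assumes "(x, y) \<in> R\<^sup>*"
  obtains xs where "xs \<noteq> []" "hd xs = x" "last xs = y" "distinct xs" "successively (\<lambda>a b. (a, b) \<in> R) xs"
proof -
  from assms have "\<exists>xs. xs \<noteq> [] \<and> hd xs = x \<and> last xs = y \<and> distinct xs \<and> successively (\<lambda>a b. (a, b) \<in> R) xs"
  proof (induction rule: converse_rtrancl_induct)
    case base
    show ?case by (intro exI[of _ "[y]"]) simp
  next
    case (step x z)
    then obtain xs where xs: "xs \<noteq> []" "hd xs = z" "last xs = y" "distinct xs" "successively (\<lambda>a b. (a, b) \<in> R) xs"
      by blast
    show ?case
    proof (cases "x \<in> set xs")
      case True
      \<comment> \<open>If the new vertex occurs already, the list from that occurrence on is kept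
        and the loop before it is dropped.\<close>
      then obtain as bs where "xs = as @ x # bs" by (meson split_list)
      with xs show ?thesis
        by (intro exI[of _ "x # bs"]) (auto simp: successively_append_iff)
    next
      case False
      with xs step.hyps(1) show ?thesis
        by (intro exI[of _ "x # xs"]) (auto simp: successively_Cons)
    qed
  qed
  with that show thesis by blast
qed

text \<open>Zipping a vertex list with its shift by one, ended by \<open>w\<close>, gives the arc
  list of a walk; \<open>w = u\<close> yields the closed walk of a cycle.\<close>

lemma pcas_zip: "pcas u (zip (u # xs) (xs @ [w])) w"
  by (induction xs arbitrary: u) auto

lemma pawalk_verts_zip: "pawalk_verts u (zip (u # xs) (xs @ [w])) = u # xs @ [w]"
  by (induction xs arbitrary: u) auto

lemma set_zip_successively:
  "successively (\<lambda>a b. (a, b) \<in> R) (u # xs) \<Longrightarrow> (last (u # xs), w) \<in> R \<Longrightarrow> set (zip (u # xs) (xs @ [w])) \<subseteq> R"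
  by (induction xs arbitrary: u) auto

lemma last_in_set_zip: "(last (u # xs), w) \<in> set (zip (u # xs) (xs @ [w]))"
  by (induction xs arbitrary: u) auto

text \<open>A path from \<open>y\<close> to \<open>x\<close> without repeated vertices, closed up by
  the edge, is a cycle. This brings the restriction to the listed cycles to bear: an edge on none of
  them is a bridge.\<close>

lemma cycle_through_edge:
  assumes G: "pair_digraph G" and xy: "(x, y) \<in> parcs (underlying G)"
    and conn: "(y, x) \<in> (parcs (underlying G) - {(x, y), (y, x)})\<^sup>*"
  obtains H where "subgraph (with_proj H) (with_proj G)" "cycle_graph H" "(x, y) \<in> parcs (underlying H)"
proof -
  interpret pair_digraph G by (rule G)
  let ?S = "parcs (underlying G)"
  have "x \<noteq> y" using xy pair_no_loops by (fastforce simp: parcs_underlying)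
  obtain xs where xs: "xs \<noteq> []" "hd xs = y" "last xs = x" "distinct xs"
    "successively (\<lambda>a b. (a, b) \<in> ?S - {(x, y), (y, x)}) xs"
    using rtrancl_distinct_list[OF conn] by blast
  from xs(1,2) obtain ys where ys: "xs = y # ys" by (cases xs) auto
  have "ys \<noteq> []" using xs(3) ys \<open>x \<noteq> y\<close> by auto
  then obtain z zs where zs: "ys = z # zs" by (cases ys) auto
  \<comment> \<open>Otherwise the path would be the removed edge itself.\<close>
  have "zs \<noteq> []" using xs(3,5) ys zs by auto
  then have len: "3 \<le> length xs" by (cases zs) (simp_all add: ys zs)
  define p where "p = zip xs (ys @ [y])"
  have walk: "pcas y p y" "pawalk_verts y p = xs @ [y]"
    unfolding p_def ys by (rule pcas_zip, simp only: pawalk_verts_zip append_Cons)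
  have "successively (\<lambda>a b. (a, b) \<in> ?S) (y # ys)"
    using xs(5) unfolding ys by (rule successively_mono) auto
  then have pS: "set p \<subseteq> ?S"
    unfolding p_def ys using xs(3) xy ys by (intro set_zip_successively) auto
  have fst_p: "fst ` set p = set xs" "snd ` set p = set xs"
    unfolding p_def by (simp_all add: set_map[symmetric] ys del: set_map zip_Cons_Cons)
  \<comment> \<open>The arcs keep their orientation from \<open>G\<close>, so that \<open>H\<close>
    is a subgraph although \<open>p\<close> may traverse them backwards.\<close>
  define H where "H = \<lparr>pverts = set xs, parcs = parcs G \<inter> (set p \<union> (set p)\<inverse>)\<rparr>"
  have H: "parcs (underlying H) = set p \<union> (set p)\<inverse>" "pverts H = fst ` set p"
    using pS fst_p(1) by (auto simp: parcs_underlying H_def)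
  have ends: "a \<in> set xs" "b \<in> set xs" if "(a, b) \<in> set p" for a b
    using that fst_p by force+
  show thesis
  proof
    have "wf_digraph (with_proj H)"
      by unfold_locales (auto simp: H_def dest: ends)
    moreover have "set xs \<subseteq> pverts G"
    proof
      fix a assume "a \<in> set xs"
      then obtain b where "(a, b) \<in> set p" using fst_p(1) by force
      then have "(a, b) \<in> parcs G \<or> (b, a) \<in> parcs G" using pS by (auto simp: parcs_underlying)
      then show "a \<in> pverts G" by (auto dest: in_arcsD1 in_arcsD2)
    qed
    ultimately show "subgraph (with_proj H) (with_proj G)"
      unfolding subgraph_def using wf_digraph_axioms by (auto simp: H_def)
    show "cycle_graph H"
      unfolding cycle_graph_def pre_digraph.cycle_def pre_digraph.awalk_def
        cas_with_proj_eq awalk_verts_with_proj_eq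
    proof (intro exI conjI)
      show "pcas y p y" by (rule walk)
      show "pverts H = fst ` set p" "parcs (underlying H) = set p \<union> (set p)\<inverse>" by (fact H)+
      show "distinct (tl (pawalk_verts y p))" unfolding walk(2) using xs(4) by (simp add: ys)
      show "3 \<le> length p" "p \<noteq> []" using len by (auto simp: p_def ys)
      show "y \<in> verts (with_proj (underlying H))" by (simp add: H_def ys)
      show "set p \<subseteq> arcs (with_proj (underlying H))" by (simp add: H(1))
    qed
    show "(x, y) \<in> parcs (underlying H)"
      unfolding H(1) using last_in_set_zip[of y ys y] xs(3) by (simp add: p_def ys)
  qed
qed

lemma cyclic_enum_field: "cyclic_enum c n V U \<Longrightarrow> (x, y) \<in> U \<Longrightarrow> x \<in> V \<and> y \<in> V"
  by (auto simp: cyclic_enum_def)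

lemma cyclic_enum_sym: "cyclic_enum c n V U \<Longrightarrow> (x, y) \<in> U \<Longrightarrow> (y, x) \<in> U"
  by (auto simp: cyclic_enum_def)

lemma path_enum_field: "path_enum c n V U \<Longrightarrow> (x, y) \<in> U \<Longrightarrow> x \<in> V \<and> y \<in> V"
  by (auto simp: path_enum_def)

lemma path_enum_sym: "path_enum c n V U \<Longrightarrow> (x, y) \<in> U \<Longrightarrow> (y, x) \<in> U"
  by (auto simp: path_enum_def)

text \<open>With \<open>x\<close> rotated to index 0, its neighbours have the indices
  \<open>n - 1\<close> and 1, which differ since \<open>3 \<le> n\<close>.\<close>

lemma cyclic_enum_two_neighbours:
  assumes "cyclic_enum c n V U" "x \<in> V" "(x, y) \<in> U"
  obtains z where "U `` {x} = {y, z}" "y \<noteq> z"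
proof -
  from cyclic_enum_rotate[OF assms(1,2)] obtain c' where c': "cyclic_enum c' n V U" "c' 0 = x" .
  then have n: "3 \<le> n" "inj_on c' {..<n}" by (auto simp: cyclic_enum_def)
  have "c' (n - 1) \<noteq> c' 1" using inj_on_contraD[OF n(2), of "n - 1" 1] n(1) by simp
  moreover have "U `` {x} = {c' (n - 1), c' 1}"
    using cyclic_enum_Image[OF c'(1), of 0] c'(2) n by simp
  ultimately have U: "U `` {x} = {c' (n - 1), c' 1}" "c' (n - 1) \<noteq> c' 1" by simp_all
  moreover have "y \<in> U `` {x}" using assms(3) by simp
  ultimately consider "y = c' (n - 1)" | "y = c' 1" by auto
  then show thesis
  proof cases
    case 1
    then show thesis using that[of "c' 1"] U by simp
  next
    case 2
    then show thesis using that[of "c' (n - 1)"] U by (simp add: insert_commute)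
  qed
qed

lemma path_enum_nth: "path_enum q m V U \<Longrightarrow> s < m \<Longrightarrow> (q s, q (Suc s)) \<in> U"
  by (auto simp: path_enum_def)

lemma rtrancl_reverse: "sym R \<Longrightarrow> (x, y) \<in> R\<^sup>* \<Longrightarrow> (y, x) \<in> R\<^sup>*"
  by (rule symD[OF sym_rtrancl])

subsection \<open>Cycles and lollipops attached to a vertex\<close>

text \<open>Everything is stated for symmetric relations; \<open>\<alpha>\<close> alone remembers
  orientation and weights. \<open>closed_edge\<close> is the form in which the absence of further
  cycles is used. Distinct lollipops are separated by \<open>UP_disj\<close> only; their
  vertex-disjointness away from \<open>v\<close> is derived.\<close>

locale cycle_bouquet =
  fixes S :: "'v rel" and \<alpha> :: "'v \<Rightarrow> 'v \<Rightarrow> int" and v :: 'v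
    and \<C> :: "'c set" and V :: "'c \<Rightarrow> 'v set" and U :: "'c \<Rightarrow> 'v rel"
    and I :: "'i set" and VC :: "'i \<Rightarrow> 'v set" and UC :: "'i \<Rightarrow> 'v rel"
    and VP :: "'i \<Rightarrow> 'v set" and UP :: "'i \<Rightarrow> 'v rel"
  assumes S: "S = (\<Union>H\<in>\<C>. U H) \<union> (\<Union>i\<in>I. UC i \<union> UP i)"
    and irrefl: "(x, x) \<notin> S"
    and pos: "\<And>x y. (x, y) \<in> S \<Longrightarrow> 0 < \<alpha> x y"
    and cyc: "H \<in> \<C> \<Longrightarrow> \<exists>c n. cyclic_enum c n (V H) (U H)"
    and cycC: "i \<in> I \<Longrightarrow> \<exists>c n. cyclic_enum c n (VC i) (UC i)"
    and path: "i \<in> I \<Longrightarrow> \<exists>q m. path_enum q m (VP i) (UP i) \<and> q 0 = v \<and> q m \<in> VC i"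
    and V_disj: "H \<in> \<C> \<Longrightarrow> H' \<in> \<C> \<Longrightarrow> H \<noteq> H' \<Longrightarrow> V H \<inter> V H' \<subseteq> {v}"
    and VC_V: "i \<in> I \<Longrightarrow> H \<in> \<C> \<Longrightarrow> VC i \<inter> V H = {}"
    and v_VC: "i \<in> I \<Longrightarrow> v \<notin> VC i"
    and VP_V: "i \<in> I \<Longrightarrow> H \<in> \<C> \<Longrightarrow> VP i \<inter> V H \<subseteq> {v}"
    and UP_disj: "i \<in> I \<Longrightarrow> j \<in> I \<Longrightarrow> i \<noteq> j \<Longrightarrow> UP i \<inter> UP j = {}"
    and closed_edge: "\<And>x y. (x, y) \<in> S \<Longrightarrow> (y, x) \<in> (S - {(x, y), (y, x)})\<^sup>* \<Longrightarrow>
        (\<exists>H\<in>\<C>. (x, y) \<in> U H) \<or> (\<exists>i\<in>I. (x, y) \<in> UC i)"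
begin

lemma U_field: "H \<in> \<C> \<Longrightarrow> (x, y) \<in> U H \<Longrightarrow> x \<in> V H \<and> y \<in> V H"
  using cyc[of H] cyclic_enum_field[of _ _ "V H" "U H" x y] by blast

lemma U_sym: "H \<in> \<C> \<Longrightarrow> (x, y) \<in> U H \<Longrightarrow> (y, x) \<in> U H"
  using cyc[of H] cyclic_enum_sym[of _ _ "V H" "U H" x y] by blast

lemma UC_field: "i \<in> I \<Longrightarrow> (x, y) \<in> UC i \<Longrightarrow> x \<in> VC i \<and> y \<in> VC i"
  using cycC[of i] cyclic_enum_field[of _ _ "VC i" "UC i" x y] by blast

lemma UC_sym: "i \<in> I \<Longrightarrow> (x, y) \<in> UC i \<Longrightarrow> (y, x) \<in> UC i"
  using cycC[of i] cyclic_enum_sym[of _ _ "VC i" "UC i" x y] by blast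

lemma UP_field: "i \<in> I \<Longrightarrow> (x, y) \<in> UP i \<Longrightarrow> x \<in> VP i \<and> y \<in> VP i"
  using path[of i] path_enum_field[of _ _ "VP i" "UP i" x y] by blast

lemma UP_sym: "i \<in> I \<Longrightarrow> (x, y) \<in> UP i \<Longrightarrow> (y, x) \<in> UP i"
  using path[of i] path_enum_sym[of _ _ "VP i" "UP i" x y] by blast

lemma S_cases:
  assumes "(x, y) \<in> S"
  obtains H where "H \<in> \<C>" "(x, y) \<in> U H" "x \<in> V H" "y \<in> V H"
  | i where "i \<in> I" "(x, y) \<in> UC i" "x \<in> VC i" "y \<in> VC i"
  | i where "i \<in> I" "(x, y) \<in> UP i" "x \<in> VP i" "y \<in> VP i"
  using assms U_field UC_field UP_field unfolding S by blast

lemma S_sym: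
  assumes "(x, y) \<in> S"
  shows "(y, x) \<in> S"
  using assms
proof (cases rule: S_cases)
  case (1 H)
  then show ?thesis using U_sym[OF 1(1,2)] unfolding S by blast
next
  case (2 i)
  then show ?thesis using UC_sym[OF 2(1,2)] unfolding S by blast
next
  case (3 i)
  then show ?thesis using UP_sym[OF 3(1,2)] unfolding S by blast
qed

text \<open>A vertex \<open>x \<noteq> v\<close> of a bouquet cycle lies on no other cycle and on no
  path, so its degree is two; and every edge has an end different from \<open>v\<close>.\<close>

lemma rigid_cycle_edge:
  assumes H: "H \<in> \<C>" "(x, y) \<in> U H"
  shows "rigid S \<alpha> x y"
proof -
  have *: "rigid S \<alpha> x y" if xy: "(x, y) \<in> U H" "x \<noteq> v" for x y
  proof -
    have x: "x \<in> V H" using U_field H(1) xy(1) by blast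
    have nbrs: "S `` {x} = U H `` {x}"
    proof (intro equalityI subsetI)
      fix z assume "z \<in> S `` {x}"
      then have "(x, z) \<in> S" by blast
      then show "z \<in> U H `` {x}"
      proof (cases rule: S_cases)
        case (1 H')
        then show ?thesis using V_disj[OF H(1), of H'] x xy(2) by blast
      next
        case (2 i)
        then show ?thesis using VC_V[OF _ H(1)] x by blast
      next
        case (3 i)
        then show ?thesis using VP_V[OF _ H(1)] x xy(2) by blast
      qed
    qed (use S H(1) in blast)
    obtain c n where c: "cyclic_enum c n (V H) (U H)" using cyc H(1) by blast
    obtain z where z: "U H `` {x} = {y, z}" "y \<noteq> z"
      using cyclic_enum_two_neighbours[OF c x xy(1)] .
    show ?thesis by (rule rigid_degree_two[OF nbrs[unfolded z(1)] z(2) pos])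
  qed
  have "x \<noteq> y" using irrefl H S by blast
  then consider "x \<noteq> v" | "y \<noteq> v" by blast
  then show ?thesis
    using *[OF H(2)] *[OF U_sym[OF H]] by cases (auto intro: rigid_sym)
qed

lemma lollipop_path:
  assumes "i \<in> I"
  obtains q m where "path_enum q m (VP i) (UP i)" "q 0 = v" "q m \<in> VC i" "0 < m"
proof -
  from path[OF assms] obtain q m where q: "path_enum q m (VP i) (UP i)" "q 0 = v" "q m \<in> VC i" by blast
  moreover have "0 < m" using q(2,3) v_VC[OF assms] by (cases m) auto
  ultimately show thesis using that by blast
qed

text \<open>Removing \<open>v\<close> leaves a lollipop connected, as the path without its first
  edge still leads to the cycle. This provides detours that avoid the edges at
  \<open>v\<close>.\<close>

lemma lollipop_connected:
  assumes i: "i \<in> I" and q: "path_enum q m (VP i) (UP i)" "q 0 = v" "q m \<in> VC i" "0 < m"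
    and z: "z \<in> VC i \<union> VP i" "z \<noteq> v"
  shows "(q 1, z) \<in> {(x, y) \<in> S. x \<noteq> v \<and> y \<noteq> v}\<^sup>*"
proof -
  let ?R = "{(x, y) \<in> S. x \<noteq> v \<and> y \<noteq> v}"
  have q_neq: "q s \<noteq> v" if "0 < s" "s \<le> m" for s
    using q(1,2) that inj_on_contraD[of q "{..m}" s 0] by (auto simp: path_enum_def)
  have path: "(q 1, q (Suc s)) \<in> ?R\<^sup>*" if "Suc s \<le> m" for s
    using that
  proof (induction s)
    case (Suc s)
    have "(q (Suc s), q (Suc (Suc s))) \<in> ?R"
      using path_enum_nth[OF q(1), of "Suc s"] Suc.prems q_neq i S by auto
    with Suc show ?case by (simp add: rtrancl_into_rtrancl)
  qed simp
  show ?thesis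
  proof (cases "z \<in> VC i")
    case True
    obtain c n where "cyclic_enum c n (VC i) (UC i)" using cycC[OF i] by blast
    then have "(q m, z) \<in> (UC i)\<^sup>*" using q(3) True by (rule cyclic_enum_connected)
    moreover have "UC i \<subseteq> ?R" using UC_field[OF i] v_VC[OF i] i S by blast
    ultimately have "(q m, z) \<in> ?R\<^sup>*" using rtrancl_mono by blast
    then show ?thesis using path[of "m - 1"] q(4) by auto
  next
    case False
    then obtain s where "s \<le> m" "z = q s" using z(1) q(1) by (auto simp: path_enum_def)
    with z(2) q(2) path[of "s - 1"] show ?thesis by (cases s) auto
  qed
qed

text \<open>If the lollipops met at \<open>z \<noteq> v\<close>, a walk from \<open>q 1\<close>
  through \<open>z\<close> and \<open>r 1\<close> to \<open>v\<close> would avoid the edge between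
  \<open>v\<close> and \<open>q 1\<close>. That edge would then lie on a listed cycle, but the
  lollipop cycles avoid \<open>v\<close>, and a bouquet cycle meets the path in \<open>v\<close>
  only. Edge-disjointness of the paths enters as \<open>q 1 \<noteq> r 1\<close>.\<close>

lemma lollipops_disjoint:
  assumes ij: "i \<in> I" "j \<in> I" "i \<noteq> j" and z: "z \<in> VC i \<union> VP i" "z \<in> VC j \<union> VP j"
  shows "z = v"
proof (rule ccontr)
  assume "z \<noteq> v"
  let ?R = "{(x, y) \<in> S. x \<noteq> v \<and> y \<noteq> v}"
  obtain q m where q: "path_enum q m (VP i) (UP i)" "q 0 = v" "q m \<in> VC i" "0 < m"
    using lollipop_path[OF ij(1)] .
  obtain r k where r: "path_enum r k (VP j) (UP j)" "r 0 = v" "r k \<in> VC j" "0 < k"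
    using lollipop_path[OF ij(2)] .
  let ?S = "S - {(v, q 1), (q 1, v)}"
  have a: "(v, q 1) \<in> UP i" and b: "(v, r 1) \<in> UP j"
    using path_enum_nth[OF q(1,4)] q(2) path_enum_nth[OF r(1,4)] r(2) by simp_all
  have aS: "(v, q 1) \<in> S" and bS: "(r 1, v) \<in> S"
    using a UP_sym[OF ij(2) b] ij(1,2) unfolding S by blast+
  have "q 1 \<noteq> r 1" using a b UP_disj[OF ij] by auto
  have "q 1 \<noteq> v" using aS irrefl by auto
  have "sym ?R" using S_sym by (auto simp: sym_def)
  then have "(q 1, r 1) \<in> ?R\<^sup>*"
    using rtrancl_trans[OF lollipop_connected[OF ij(1) q z(1) \<open>z \<noteq> v\<close>]
      rtrancl_reverse[OF _ lollipop_connected[OF ij(2) r z(2) \<open>z \<noteq> v\<close>]]] by blast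
  moreover have "?R \<subseteq> ?S" by auto
  ultimately have "(q 1, r 1) \<in> ?S\<^sup>*" using rtrancl_mono by blast
  moreover have "(r 1, v) \<in> ?S" using bS \<open>q 1 \<noteq> r 1\<close> \<open>q 1 \<noteq> v\<close> by auto
  ultimately have "(q 1, v) \<in> ?S\<^sup>*" by (rule rtrancl_into_rtrancl)
  from closed_edge[OF aS this] show False
  proof
    assume "\<exists>H\<in>\<C>. (v, q 1) \<in> U H"
    then obtain H where "H \<in> \<C>" "q 1 \<in> V H" using U_field by blast
    then show False using VP_V[OF ij(1)] UP_field[OF ij(1) a] \<open>q 1 \<noteq> v\<close> by blast
  next
    assume "\<exists>i\<in>I. (v, q 1) \<in> UC i"
    then show False using UC_field v_VC by blast
  qed
qed

lemma lollipop_neighbours: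
  assumes i: "i \<in> I" and x: "x \<in> VC i \<union> VP i" "x \<noteq> v"
  shows "S `` {x} = UC i `` {x} \<union> UP i `` {x}"
proof (intro equalityI subsetI)
  fix z assume "z \<in> S `` {x}"
  then have "(x, z) \<in> S" by blast
  then show "z \<in> UC i `` {x} \<union> UP i `` {x}"
  proof (cases rule: S_cases)
    case (1 H)
    then show ?thesis using VC_V[OF i] VP_V[OF i] x by blast
  next
    case (2 j)
    then show ?thesis using lollipops_disjoint[OF i 2(1) _ x(1)] x(2) by blast
  next
    case (3 j)
    then show ?thesis using lollipops_disjoint[OF i 3(1) _ x(1)] x(2) by blast
  qed
qed (use S i in blast)

text \<open>
  A path may run along its cycle after first reaching it. It cannot leave the cycle, as an edge
  outside the cycle would close up to a further cycle.
\<close>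

lemma path_after_entry:
  assumes i: "i \<in> I" and q: "path_enum q m (VP i) (UP i)" "q 0 = v" "q m \<in> VC i"
    and l: "l \<le> m" "q l \<in> VC i" and s: "l \<le> s" "s < m"
  shows "(q s, q (Suc s)) \<in> UC i"
proof (rule ccontr)
  assume notin: "(q s, q (Suc s)) \<notin> UC i"
  let ?S = "S - {(q s, q (Suc s)), (q (Suc s), q s)}"
  have inj: "q a = q b \<longleftrightarrow> a = b" if "a \<le> m" "b \<le> m" for a b
    using q(1) that by (auto simp: path_enum_def inj_on_eq_iff)
  have symS: "sym ?S" using S_sym by (auto simp: sym_def)
  have step: "(q t, q (Suc t)) \<in> ?S" if "t < m" "t \<noteq> s" for t
    using path_enum_nth[OF q(1) that(1)] i S inj that s(2) by auto
  have walk: "(q a, q (a + d)) \<in> ?S\<^sup>*" if "a + d \<le> m" "s < a \<or> a + d \<le> s" for a d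
    using that
  proof (induction d)
    case (Suc d)
    then show ?case using step[of "a + d"] by (auto intro: rtrancl_into_rtrancl)
  qed simp
  \<comment> \<open>The detour around the edge: forward on the path to \<open>q m\<close>, along the
    cycle to \<open>q l\<close>, forward on the path to \<open>q s\<close>.\<close>
  have "(q (Suc s), q m) \<in> ?S\<^sup>*" using walk[of "Suc s" "m - Suc s"] s by simp
  moreover have "(q m, q l) \<in> ?S\<^sup>*"
  proof -
    obtain c n where "cyclic_enum c n (VC i) (UC i)" using cycC[OF i] by blast
    then have "(q m, q l) \<in> (UC i)\<^sup>*" using q(3) l(2) by (rule cyclic_enum_connected)
    moreover have "UC i \<subseteq> ?S" using notin UC_sym[OF i, of "q (Suc s)" "q s"] i S by blast
    ultimately show ?thesis using rtrancl_mono by blast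
  qed
  moreover have "(q l, q s) \<in> ?S\<^sup>*" using walk[of l "s - l"] s by simp
  ultimately have conn: "(q (Suc s), q s) \<in> ?S\<^sup>*" by (meson rtrancl_trans)
  have edge: "(q s, q (Suc s)) \<in> UP i" by (rule path_enum_nth[OF q(1) s(2)])
  then have "(q s, q (Suc s)) \<in> S" using i S by blast
  \<comment> \<open>A bouquet cycle would force both ends to be \<open>v\<close>; another lollipop
    meets this one at most in \<open>v\<close>, which its cycle avoids.\<close>
  from closed_edge[OF this conn] show False
  proof
    assume "\<exists>H\<in>\<C>. (q s, q (Suc s)) \<in> U H"
    then obtain H where "H \<in> \<C>" "q s \<in> V H" "q (Suc s) \<in> V H" using U_field by blast
    then have "q s = v" "q (Suc s) = v" using VP_V[OF i] UP_field[OF i edge] by blast+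
    then show False using inj[of s "Suc s"] s by simp
  next
    assume "\<exists>j\<in>I. (q s, q (Suc s)) \<in> UC j"
    then obtain j where j: "j \<in> I" "(q s, q (Suc s)) \<in> UC j" by blast
    then have "j \<noteq> i" "q s \<in> VC j" using notin UC_field by blast+
    then have "q s = v" using lollipops_disjoint[OF i j(1), of "q s"] UP_field[OF i edge] by blast
    then show False using v_VC j(1) \<open>q s \<in> VC j\<close> by blast
  qed
qed

text \<open>The path is cut at its first vertex on the cycle. Later edges already belong to the
  cycle, so the union is unchanged, and the remaining stick meets the cycle only at its end
  \<open>q l\<close>.\<close>

lemma lollipop_entry:
  assumes i: "i \<in> I"
  obtains q l where "inj_on q {..l}" "q 0 = v" "q l \<in> VC i" "0 < l" "\<And>s. s < l \<Longrightarrow> q s \<notin> VC i"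
    "\<And>s. s \<le> l \<Longrightarrow> q s \<in> VP i"
    "UC i \<union> UP i = UC i \<union> (\<Union>s<l. {(q s, q (Suc s)), (q (Suc s), q s)})"
proof -
  obtain q m where q: "path_enum q m (VP i) (UP i)" "q 0 = v" "q m \<in> VC i" "0 < m"
    using lollipop_path[OF i] .
  define l where "l = (LEAST s. q s \<in> VC i)"
  have l: "q l \<in> VC i" "l \<le> m" "\<And>s. s < l \<Longrightarrow> q s \<notin> VC i"
    unfolding l_def using q(3) by (auto intro: LeastI Least_le dest: not_less_Least)
  have "0 < l" using l(1) q(2) v_VC[OF i] by (cases l) auto
  have UP: "UP i = (\<Union>s<m. {(q s, q (Suc s)), (q (Suc s), q s)})" using q(1) by (simp add: path_enum_def)
  have after: "(q s, q (Suc s)) \<in> UC i" if "l \<le> s" "s < m" for s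
    using path_after_entry[OF i q(1-3) l(2,1) that] .
  have "{..<m} = {..<l} \<union> {l..<m}" using l(2) by auto
  moreover have "(\<Union>s\<in>{l..<m}. {(q s, q (Suc s)), (q (Suc s), q s)}) \<subseteq> UC i"
    using after UC_sym[OF i after] by auto
  ultimately have eq: "UC i \<union> UP i = UC i \<union> (\<Union>s<l. {(q s, q (Suc s)), (q (Suc s), q s)})"
    unfolding UP UN_Un by auto
  show thesis
  proof (rule that[of q l])
    show "inj_on q {..l}" using q(1) l(2) by (auto simp: path_enum_def intro: inj_on_subset)
    show "q s \<in> VP i" if "s \<le> l" for s using q(1) l(2) that by (auto simp: path_enum_def)
  qed (fact q l eq \<open>0 < l\<close>)+
qed

text \<open>Away from \<open>v\<close>, only the entry vertex \<open>q l\<close> has degree three,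
  and a cycle edge always has an end other than \<open>q l\<close>.\<close>

lemma rigid_lollipop_edge:
  assumes i: "i \<in> I" and xy: "(x, y) \<in> UC i \<union> UP i"
  shows "rigid S \<alpha> x y"
proof -
  obtain q l where q: "inj_on q {..l}" "q 0 = v" "q l \<in> VC i" "0 < l" "\<And>s. s < l \<Longrightarrow> q s \<notin> VC i"
    "\<And>s. s \<le> l \<Longrightarrow> q s \<in> VP i"
    and UCP: "UC i \<union> UP i = UC i \<union> (\<Union>s<l. {(q s, q (Suc s)), (q (Suc s), q s)})"
    using lollipop_entry[OF i] by blast
  have inj: "q a = q b \<longleftrightarrow> a = b" if "a \<le> l" "b \<le> l" for a b
    using q(1) that by (auto simp: inj_on_eq_iff)
  have S_nbrs: "S `` {x} = UC i `` {x} \<union> (\<Union>s<l. {(q s, q (Suc s)), (q (Suc s), q s)}) `` {x}"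
    if "x \<in> VC i \<union> VP i" "x \<noteq> v" for x
    using lollipop_neighbours[OF i that] UCP by blast
  have q_neq: "q s \<noteq> v" if "0 < s" "s \<le> l" for s using inj[of s 0] that q(2) by simp
  have nbrs_cycle: "S `` {x} = UC i `` {x}" if x: "x \<in> VC i" "x \<noteq> q l" for x
  proof -
    have "(\<Union>s<l. {(q s, q (Suc s)), (q (Suc s), q s)}) `` {x} = {}"
    proof -
      have "x \<noteq> q s \<and> x \<noteq> q (Suc s)" if "s < l" for s
        using q(5)[of s] q(5)[of "Suc s"] x that by (cases "Suc s = l") auto
      then show ?thesis by blast
    qed
    then show ?thesis using S_nbrs[of x] x v_VC[OF i] by auto
  qed
  have UC_edge: "rigid S \<alpha> x y" if xy: "(x, y) \<in> UC i" "x \<noteq> q l" for x y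
  proof -
    have x: "x \<in> VC i" using UC_field[OF i xy(1)] by blast
    obtain c n where c: "cyclic_enum c n (VC i) (UC i)" using cycC[OF i] by blast
    obtain z where z: "UC i `` {x} = {y, z}" "y \<noteq> z"
      using cyclic_enum_two_neighbours[OF c x xy(1)] .
    show ?thesis by (rule rigid_degree_two[OF nbrs_cycle[OF x xy(2), unfolded z(1)] z(2) pos])
  qed
  have nbrs_path: "S `` {q (Suc s)} = {q s, q (Suc (Suc s))}" if s: "Suc s < l" for s
  proof -
    have "UC i `` {q (Suc s)} = {}" using UC_field[OF i] q(5)[OF s] by blast
    moreover have "(\<Union>s<l. {(q s, q (Suc s)), (q (Suc s), q s)}) `` {q (Suc s)} = {q s, q (Suc (Suc s))}"
    proof (intro equalityI subsetI)
      fix z assume "z \<in> (\<Union>s<l. {(q s, q (Suc s)), (q (Suc s), q s)}) `` {q (Suc s)}"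
      then obtain t where t: "t < l" "q (Suc s) = q t \<and> z = q (Suc t) \<or> q (Suc s) = q (Suc t) \<and> z = q t"
        by auto
      then show "z \<in> {q s, q (Suc (Suc s))}" using inj[of "Suc s" t] inj[of "Suc s" "Suc t"] s by auto
    next
      fix z assume "z \<in> {q s, q (Suc (Suc s))}"
      moreover have "s < l" "Suc s < l" using s by auto
      ultimately show "z \<in> (\<Union>s<l. {(q s, q (Suc s)), (q (Suc s), q s)}) `` {q (Suc s)}" by blast
    qed
    ultimately show ?thesis using S_nbrs[of "q (Suc s)"] q(6)[of "Suc s"] q_neq[of "Suc s"] s by simp
  qed
  have path_edge: "rigid S \<alpha> (q (Suc s)) (q s)" if s: "s < l" for s
  proof -
    \<comment> \<open>The end of degree two is \<open>q (Suc s)\<close> unless that is the entry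
      vertex, and then \<open>q s\<close> unless that is \<open>v\<close>. What remains is a stick
      of a single edge.\<close>
    consider "Suc s < l" | t where "Suc s = l" "s = Suc t" | "Suc s = l" "s = 0" using s by (cases s) force+
    then show ?thesis
    proof cases
      case 1
      have "q s \<noteq> q (Suc (Suc s))" using inj[of s "Suc (Suc s)"] 1 by simp
      then show ?thesis by (rule rigid_degree_two[OF nbrs_path[OF 1] _ pos])
    next
      case (2 t)
      have t: "Suc t < l" using 2 by simp
      have "S `` {q (Suc t)} = {q (Suc (Suc t)), q t}" using nbrs_path[OF t] by auto
      moreover have "q (Suc (Suc t)) \<noteq> q t" using inj[of "Suc (Suc t)" t] t by simp
      ultimately have "rigid S \<alpha> (q (Suc t)) (q (Suc (Suc t)))" by (rule rigid_degree_two[OF _ _ pos])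
      then show ?thesis using 2 rigid_sym by simp
    next
      case 3
      obtain c0 n where c0: "cyclic_enum c0 n (VC i) (UC i)" using cycC[OF i] by blast
      obtain c where c: "cyclic_enum c n (VC i) (UC i)" "c 0 = q l"
        using cyclic_enum_rotate[OF c0 q(3)] .
      from c(1) have n: "3 \<le> n" and inj_c: "inj_on c {..<n}" and VC: "VC i = c ` {..<n}"
        by (auto simp: cyclic_enum_def)
      have "rigid S \<alpha> (c 0) v"
      proof (rule rigid_pendant[OF n inj_c _ _ _ pos])
        show "v \<notin> c ` {..<n}" using v_VC[OF i] VC by simp
        have "UC i `` {c 0} = {c 1, c (n - 1)}" using cyclic_enum_Image[OF c(1), of 0] n by auto
        moreover have "(\<Union>s<l. {(q s, q (Suc s)), (q (Suc s), q s)}) `` {q l} = {v}"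
          using 3 q(2) inj[of 0 l] by auto
        ultimately show "S `` {c 0} = {v, c 1, c (n - 1)}"
          using S_nbrs[of "q l"] q(3) q_neq[of l] q(4) c(2) by auto
        fix s assume s: "Suc s < n"
        have "c (Suc s) \<noteq> c 0" using inj_on_contraD[OF inj_c, of "Suc s" 0] s by simp
        moreover have "c (Suc s) \<in> VC i" using VC s by auto
        ultimately show "S `` {c (Suc s)} = {c s, c (Suc (Suc s) mod n)}"
          using nbrs_cycle[of "c (Suc s)"] cyclic_enum_Image[OF c(1) s] c(2) by simp
      qed
      then show ?thesis using 3 c(2) q(2) by simp
    qed
  qed
  show ?thesis
  proof (cases "(x, y) \<in> UC i")
    case True
    then have "x \<noteq> y" using irrefl i S by blast
    then consider "x \<noteq> q l" | "y \<noteq> q l" by blast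
    then show ?thesis
      using UC_edge[OF True] UC_edge[OF UC_sym[OF i True]] by cases (auto intro: rigid_sym)
  next
    case False
    then obtain s where "s < l" "x = q s \<and> y = q (Suc s) \<or> x = q (Suc s) \<and> y = q s"
      using xy UCP by auto
    then show ?thesis using path_edge by (auto intro: rigid_sym)
  qed
qed

lemma rigid_edge:
  assumes "(x, y) \<in> S"
  shows "rigid S \<alpha> x y"
  using assms by (cases rule: S_cases) (auto intro: rigid_cycle_edge rigid_lollipop_edge)

end

section \<open>The graph \<open>D'\<close> as a bouquet of cycles and lollipops\<close>

theorem corollary3p13:
  fixes D D' :: "'v pair_pre_digraph"
    and w :: "'v \<Rightarrow> nat"
    and v :: 'v
    and \<C> :: "'v pair_pre_digraph set"
    and k :: nat
    and C P :: "nat \<Rightarrow> 'v pair_pre_digraph"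
  assumes "weighted_oriented_graph D w"
    and "weighted_oriented_graph D' w"
    and "finite \<C>"
    and "\<And>H. H \<in> \<C> \<Longrightarrow> cycle_graph H \<and> v \<in> pverts H"
    and "\<And>H1 H2. H1 \<in> \<C> \<Longrightarrow> H2 \<in> \<C> \<Longrightarrow> H1 \<noteq> H2 \<Longrightarrow> pverts H1 \<inter> pverts H2 = {v}"
    and "pverts D = insert v (\<Union>H\<in>\<C>. pverts H)"
    and "parcs D = (\<Union>H\<in>\<C>. parcs H)"
    and "\<And>i. i \<in> {1..k} \<Longrightarrow> cycle_graph (C i) \<and> pverts (C i) \<inter> pverts D = {}"
    and "\<And>i. i \<in> {1..k} \<Longrightarrow> \<exists>u\<in>pverts (C i). path_graph v (P i) u"
    and "\<And>i. i \<in> {1..k} \<Longrightarrow> pverts (P i) \<inter> pverts D = {v}"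
    and "\<And>i j. i \<in> {1..k} \<Longrightarrow> j \<in> {1..k} \<Longrightarrow> i \<noteq> j \<Longrightarrow> parcs (P i) \<inter> parcs (P j) = {}"
    and "pverts D' = pverts D \<union> (\<Union>i\<in>{1..k}. pverts (C i) \<union> pverts (P i))"
    and "parcs D' = parcs D \<union> (\<Union>i\<in>{1..k}. parcs (C i) \<union> parcs (P i))"
    and "\<And>H. subgraph (with_proj H) (with_proj D') \<Longrightarrow> cycle_graph H \<Longrightarrow> H \<in> \<C> \<union> C ` {1..k}"
  shows "strongly_robust (mpoly_ring (parcs D'))
           (toric_ideal D' w :: ('v \<times> 'v, 'k::field) mpoly set)"
proof -
  let ?E = "parcs D'" and ?S = "parcs (underlying D')"
  let ?U = "\<lambda>H :: 'v pair_pre_digraph. parcs (underlying H)"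
  from assms(2) have D': "pair_digraph D'" and anti: "antisym ?E" and w: "\<And>x. x \<in> pverts D' \<Longrightarrow> 0 < w x"
    by (auto simp: weighted_oriented_graph_def)
  interpret pair_digraph D' by (rule D')
  have loopfree: "(x, x) \<notin> ?E" for x using pair_no_loops by fastforce
  have E_C: "parcs (C i) \<subseteq> ?E" and E_P: "parcs (P i) \<subseteq> ?E" if "i \<in> {1..k}" for i
    using assms(13) that by blast+
  have V_D: "pverts H \<subseteq> pverts D" if "H \<in> \<C>" for H using assms(6) that by blast
  interpret cycle_bouquet ?S "edge_coeff ?E w" v \<C> pverts ?U "{1..k}"
    "\<lambda>i. pverts (C i)" "\<lambda>i. ?U (C i)" "\<lambda>i. pverts (P i)" "\<lambda>i. ?U (P i)"
  proof (unfold_locales, goal_cases)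
    case 1
    show ?case unfolding parcs_underlying assms(13) assms(7) by blast
  next
    case (2 x)
    show ?case using loopfree by (simp add: parcs_underlying)
  next
    case (3 x y)
    then show ?case using w in_arcsD1 in_arcsD2 by (auto simp: edge_coeff_def parcs_underlying)
  next
    case (4 H)
    then show ?case using assms(4) cycle_graph_enum by metis
  next
    case (5 i)
    then show ?case using assms(8) cycle_graph_enum by metis
  next
    case (6 i)
    then obtain u where u: "u \<in> pverts (C i)" "path_graph v (P i) u" using assms(9) by blast
    from u(2) obtain q m where "path_enum q m (pverts (P i)) (?U (P i))" "q 0 = v" "q m = u"
      by (rule path_graph_enum)
    then show ?case using u(1) by blast
  next
    case (7 H H')
    then show ?case using assms(5) by blast
  next
    case (8 i H)
    then show ?case using assms(8) V_D by blast
  next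
    case (9 i)
    then show ?case using assms(6,8) by blast
  next
    case (10 i H)
    then show ?case using assms(10) V_D by blast
  next
    case (11 i j)
    \<comment> \<open>The hypothesis compares directed arcs; that two paths do not share an edge in
      opposite orientations follows from antisymmetry in \<open>D'\<close>.\<close>
    have "(x, y) \<notin> parcs (P j) \<and> (y, x) \<notin> parcs (P j)" if "(x, y) \<in> parcs (P i)" for x y
      using that assms(11)[OF 11] E_P[OF 11(1)] E_P[OF 11(2)] anti loopfree by (blast dest: antisymD)
    then show ?case unfolding parcs_underlying by auto
  next
    case (12 x y)
    then obtain H where H: "subgraph (with_proj H) (with_proj D')" "cycle_graph H" "(x, y) \<in> ?U H"
      using cycle_through_edge[OF D'] by blast
    then show ?case using assms(14)[OF H(1,2)] by blast
  qed
  have "rigid (?E \<union> ?E\<inverse>) (edge_coeff ?E w) x y" if "(x, y) \<in> ?E" for x y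
    using rigid_edge[of x y] that by (simp add: parcs_underlying)
  then show ?thesis
    unfolding toric_ideal_eq_monomial_kernel
    by (rule strongly_robust_if_rigid[OF pair_finite_arcs anti loopfree])
qed

end
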